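(* Let $p\in\operatorname{poly}(n)$ and let $c$ be a positive even integer. Then there exists a sufficiently large constant $b$ such that, with $\phi$ the map described in the context (using constant $b$), for every two permutations $x,y\in\mathcal{P}_{\le n}$: (1) the lengths of $\phi(x)$ and $\phi(y)$ are at most $O(|x|/c)$ and $O(|y|/c)$; (2) $\Delta_{\text{ed}}(x,y)\le c\cdot\Delta_{\text{ed}}(\phi(x),\phi(y))$; (3) the distortion of $\phi$ is $O(c)$; in particular $\Pr[\Delta_{\text{ed}}(\phi(x),\phi(y))>m\Delta_{\text{ed}}(x,y)]\le\left(\frac12\right)^{\Omega(m)}+\frac1{p(n)}$ for all $m\in\mathbb{N}$; (4) each of $\phi(x)$ and $\phi(y)$ can be computed in time $O(n)$.
   Context: $\mathcal{P}_{\le n}$ is the set of strings of length at most $n$ over alphabet $\Sigma$ with pairwise distinct letters; $\Delta_{\text{ed}}$ is edit distance. Fully independent hash functions on $\Theta(\log n)$-bit inputs with constant-time evaluation are assumed available. The map $\phi$ on input $w\in\mathcal{P}_{\le n}$ (length $n$ here meaning $|w|$): choose $h$ at random from an $n$-wise independent family mapping $\Sigma$ to $\{0,1\}^{b\log n}$. A letter $w_i$ is a marker if $c<i\le n-c$ and $h(w_i)$ is the unique minimum of $h(w_{i-c}),\dots,h(w_{i+c})$. Partition $w$ into blocks: each marker begins a new block; each block of size at least $c$ is further subdivided into blocks of size exactly $c$ except the last, which has size at most $c$. Output the string over alphabet $\Sigma^*$ whose letters are these blocks in order. *)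

theory Defs
  imports "HOL-Probability.Probability" "HOL-Library.Landau_Symbols"
begin

section \<open>Edit distance and permutations\<close>

inductive edit_step :: "'a list \<Rightarrow> 'a list \<Rightarrow> bool" where
  insertion: "edit_step (u @ v) (u @ a # v)"
| deletion: "edit_step (u @ a # v) (u @ v)"
| substitution: "edit_step (u @ a # v) (u @ b # v)"

definition edit_distance :: "'a list \<Rightarrow> 'a list \<Rightarrow> nat" where
  "edit_distance x y = (LEAST k. (edit_step ^^ k) x y)"

definition perms_le :: "nat \<Rightarrow> 'a set \<Rightarrow> 'a list set" where
  "perms_le n A = {w. set w \<subseteq> A \<and> distinct w \<and> length w \<le> n}"


section \<open>Hash families\<close>

text \<open>A family of hash functions is a probability distribution on functions.  A bit string of
  length \<open>l\<close> is identified with the number below \<open>2 ^ l\<close> that it denotes.\<close>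

definition k_wise_indep_family ::
  "nat \<Rightarrow> 'a set \<Rightarrow> nat \<Rightarrow> ('a \<Rightarrow> nat) pmf \<Rightarrow> bool" where
  "k_wise_indep_family k A l H \<longleftrightarrow>
     (\<forall>a\<in>A. map_pmf (\<lambda>h. h a) H = pmf_of_set {..<2 ^ l}) \<and>
     (\<forall>J\<subseteq>A. finite J \<and> card J \<le> k \<longrightarrow>
        prob_space.indep_vars (measure_pmf H) (\<lambda>_. count_space UNIV) (\<lambda>a h. h a) J)"

definition hash_bits :: "nat \<Rightarrow> nat \<Rightarrow> nat" where
  "hash_bits b n = nat \<lceil>real b * log 2 (real n)\<rceil>"


section \<open>The map\<close>

text \<open>Positions are counted from \<open>0\<close>, so that \<open>c \<le> i\<close> and \<open>i + c < length w\<close> say that the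
  window of radius \<open>c\<close> around position \<open>i\<close> lies inside \<open>w\<close>.\<close>

definition marker :: "nat \<Rightarrow> ('a \<Rightarrow> nat) \<Rightarrow> 'a list \<Rightarrow> nat \<Rightarrow> bool" where
  "marker c h w i \<longleftrightarrow> c \<le> i \<and> i + c < length w \<and>
     (\<forall>j\<in>{i - c..i + c} - {i}. h (w ! i) < h (w ! j))"

definition segments :: "'a list \<Rightarrow> nat list \<Rightarrow> 'a list list" where
  "segments w cuts = map (\<lambda>(i, j). take (j - i) (drop i w)) (zip cuts (tl cuts))"

function chunks :: "nat \<Rightarrow> 'a list \<Rightarrow> 'a list list" where
  "chunks c w = (if c = 0 \<or> w = [] then [] else take c w # chunks c (drop c w))"
  by pat_completeness auto
termination by (relation "Wellfounded.measure (\<lambda>(c, w). length w)") auto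

declare chunks.simps [simp del]

definition phi :: "nat \<Rightarrow> ('a \<Rightarrow> nat) \<Rightarrow> 'a list \<Rightarrow> 'a list list" where
  "phi c h w =
     concat (map (chunks c)
       (segments w (0 # filter (marker c h w) [0..<length w] @ [length w])))"


section \<open>Distortion of randomized maps\<close>

text \<open>After scaling by a fixed factor \<open>s\<close>, the map never contracts a distance, and it expands
  it in expectation by a factor of at most \<open>D\<close>.\<close>

definition expected_distortion_le ::
  "'h pmf \<Rightarrow> ('h \<Rightarrow> 'x \<Rightarrow> 'y) \<Rightarrow> 'x set \<Rightarrow> ('x \<Rightarrow> 'x \<Rightarrow> real) \<Rightarrow> ('y \<Rightarrow> 'y \<Rightarrow> real) \<Rightarrow> real \<Rightarrow> bool"
  where
  "expected_distortion_le H \<Phi> X dX dY D \<longleftrightarrow>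
     (\<exists>s>0. \<forall>x\<in>X. \<forall>y\<in>X.
        (\<forall>h\<in>set_pmf H. dX x y \<le> s * dY (\<Phi> h x) (\<Phi> h y)) \<and>
        integrable (measure_pmf H) (\<lambda>h. dY (\<Phi> h x) (\<Phi> h y)) \<and>
        s * measure_pmf.expectation H (\<lambda>h. dY (\<Phi> h x) (\<Phi> h y)) \<le> D * dX x y)"


section \<open>Word RAM programs with a hash oracle\<close>

text \<open>A state consists of registers and memory cells, each holding a word of \<open>w\<close> bits, with
  arithmetic modulo \<open>2 ^ w\<close>.  Every instruction and every test costs one time unit; this includes
  an evaluation of the hash function, which is available through \<open>Hash\<close>.\<close>

type_synonym state = "(nat \<Rightarrow> nat) \<times> (nat \<Rightarrow> nat)"

datatype instr =
    Const nat nat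
  | Add nat nat nat
  | Sub nat nat nat
  | Load nat nat
  | Store nat nat
  | Hash nat nat

fun exec_instr :: "nat \<Rightarrow> (nat \<Rightarrow> nat) \<Rightarrow> instr \<Rightarrow> state \<Rightarrow> state" where
  "exec_instr w h (Const r k) (R, M) = (R(r := k mod 2 ^ w), M)"
| "exec_instr w h (Add r s t) (R, M) = (R(r := (R s + R t) mod 2 ^ w), M)"
| "exec_instr w h (Sub r s t) (R, M) = (R(r := (R s + 2 ^ w - R t) mod 2 ^ w), M)"
| "exec_instr w h (Load r s) (R, M) = (R(r := M (R s)), M)"
| "exec_instr w h (Store r s) (R, M) = (R, M(R r := R s))"
| "exec_instr w h (Hash r s) (R, M) = (R(r := h (R s) mod 2 ^ w), M)"

datatype com =
    Skip
  | Do instr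
  | Seq com com
  | IfLess nat nat com com
  | WhileLess nat nat com

text \<open>\<open>run w h P s t s'\<close>: started in state \<open>s\<close>, program \<open>P\<close> stops in state \<open>s'\<close> after time \<open>t\<close>.\<close>

inductive run :: "nat \<Rightarrow> (nat \<Rightarrow> nat) \<Rightarrow> com \<Rightarrow> state \<Rightarrow> nat \<Rightarrow> state \<Rightarrow> bool"
  for w :: nat and h :: "nat \<Rightarrow> nat" where
  skip: "run w h Skip s 1 s"
| instr: "run w h (Do i) s 1 (exec_instr w h i s)"
| seq: "run w h P s t s' \<Longrightarrow> run w h Q s' t' s'' \<Longrightarrow> run w h (Seq P Q) s (t + t') s''"
| if_true: "fst s r < fst s r' \<Longrightarrow> run w h P s t s' \<Longrightarrow> run w h (IfLess r r' P Q) s (1 + t) s'"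
| if_false: "\<not> fst s r < fst s r' \<Longrightarrow> run w h Q s t s' \<Longrightarrow> run w h (IfLess r r' P Q) s (1 + t) s'"
| while_true: "fst s r < fst s r' \<Longrightarrow> run w h P s t s' \<Longrightarrow> run w h (WhileLess r r' P) s' t' s'' \<Longrightarrow>
    run w h (WhileLess r r' P) s (1 + t + t') s''"
| while_false: "\<not> fst s r < fst s r' \<Longrightarrow> run w h (WhileLess r r' P) s 1 s"

text \<open>The input is \<open>length x\<close> in register \<open>0\<close>, the parameter \<open>c\<close> in register \<open>1\<close>, and the letters
  of \<open>x\<close> in the first memory cells; everything else is \<open>0\<close>.\<close>

definition input_state :: "nat \<Rightarrow> nat list \<Rightarrow> state" where
  "input_state c x =
     (\<lambda>r. if r = 0 then length x else if r = 1 then c else 0,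
      \<lambda>a. if a < length x then x ! a else 0)"

text \<open>A string of blocks is written to memory as the number of blocks, followed by each block
  preceded by its length.  When the program stops, register \<open>0\<close> holds the address of this text.\<close>

definition encode_blocks :: "nat list list \<Rightarrow> nat list" where
  "encode_blocks bs = length bs # concat (map (\<lambda>B. length B # B) bs)"

definition computes_within ::
  "com \<Rightarrow> nat \<Rightarrow> (nat \<Rightarrow> nat) \<Rightarrow> nat \<Rightarrow> nat list \<Rightarrow> nat list list \<Rightarrow> real \<Rightarrow> bool" where
  "computes_within P w h c x bs T \<longleftrightarrow>
     (\<exists>t R M. real t \<le> T \<and> run w h P (input_state c x) t (R, M) \<and>
        map M [R 0..<R 0 + length (encode_blocks bs)] = encode_blocks bs)"

end

theory Submission
  imports Defs "HOL-Library.Sublist"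
begin

text \<open>
  If one letter is deleted, the markers at distance more than \<open>c\<close> from it survive, so \<open>phi\<close> changes
  only between the nearest surviving markers on both sides, by \<open>O(1 + D / c)\<close> blocks if these are
  at distance \<open>D\<close>.  The word is cut into disjoint windows of length \<open>4 * c\<close>: independently of each
  other, each contains a marker with probability at least \<open>1 / 4\<close>, so \<open>D / c\<close> has a geometric tail
  whose rate does not depend on \<open>c\<close>.  If \<open>x\<close> and \<open>y\<close> are at distance \<open>d\<close>, then \<open>x\<close> turns into \<open>y\<close>
  by at most \<open>2 * d\<close> steps, first deletions down to a common subsequence and then insertions.  All
  intermediate words are subwords of \<open>x\<close> or of \<open>y\<close>, hence have at most \<open>n\<close> distinct letters, so
  that \<open>n\<close>-wise independence is enough.  The contributions of the steps are dependent, but an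
  exponential moment bound passes to their average by convexity.  Hash collisions only enter through
  the windows, where a constant \<open>b\<close> depending on \<open>c\<close> alone makes them rare.
\<close>

section \<open>Edit distance\<close>

text \<open>Between two markers the cuts depend on the distance to the previous marker, so a
  deletion shifts the cuts up to the next marker; the blocks are sure to agree again only from a
  marker that both words share. Hence \<open>phi\<close> is recast as a scan over letters paired
  with marker flags, which restarts at every flag. For the stretch between the surviving markers the
  trivial bound suffices, namely replacing all its blocks: markers are so sparse that, for every
  hash function, their number is linear in the length of the stretch over \<open>c\<close>. The
  constants have one source: markers found within \<open>t\<close> windows on both sides give the
  bound \<open>32 * t + 10\<close>, the exponential moment bounds the mean of the random variable in
  place of \<open>t\<close> by \<open>24\<close>, and
  \<open>2 * (32 * 24 + 10) = 1556\<close>.\<close>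

lemma edit_step_sym: "edit_step x y \<Longrightarrow> edit_step y x"
  by (induction rule: edit_step.induct) (auto intro: edit_step.intros)

lemma edit_step_context: "edit_step x y \<Longrightarrow> edit_step (p @ x @ s) (p @ y @ s)"
proof (induction rule: edit_step.induct)
  case (insertion u v a)
  show ?case using edit_step.insertion[of "p @ u" "v @ s" a] by simp
next
  case (deletion u a v)
  show ?case using edit_step.deletion[of "p @ u" a "v @ s"] by simp
next
  case (substitution u a v b)
  show ?case using edit_step.substitution[of "p @ u" a "v @ s" b] by simp
qed

lemma edit_step_map: "edit_step x y \<Longrightarrow> edit_step (map g x) (map g y)"
  by (induction rule: edit_step.induct) (auto intro: edit_step.intros)

lemma relpowp_edit_step_sym: "(edit_step ^^ k) x y \<Longrightarrow> (edit_step ^^ k) y x"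
proof (induction k arbitrary: y)
  case (Suc k)
  then obtain z where "(edit_step ^^ k) x z" "edit_step z y" by auto
  then show ?case using Suc.IH edit_step_sym by (blast intro: relpowp_Suc_I2)
qed simp

lemma relpowp_image:
  assumes "\<And>x y. R x y \<Longrightarrow> S (f x) (f y)" "(R ^^ k) x y"
  shows "(S ^^ k) (f x) (f y)"
  using assms(2)
proof (induction k arbitrary: y)
  case (Suc k)
  then obtain z where "(R ^^ k) x z" "R z y" by auto
  then show ?case using Suc.IH assms(1) by (blast intro: relpowp_Suc_I)
qed simp

lemma edit_step_context_relpowp:
  "(edit_step ^^ k) x y \<Longrightarrow> (edit_step ^^ k) (p @ x @ s) (p @ y @ s)"
  using relpowp_image[of edit_step edit_step "\<lambda>x. p @ x @ s"] edit_step_context by blast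

lemma edit_step_delete_all: "(edit_step ^^ length x) x []"
proof (induction x)
  case (Cons a x)
  have "edit_step (a # x) x" using edit_step.deletion[of "[]" a x] by simp
  then show ?case using Cons by (metis length_Cons relpowp_Suc_I2)
qed simp

lemma relpowp_edit_step_replace: "(edit_step ^^ (length x + length y)) x y"
  using edit_step_delete_all[of x] relpowp_edit_step_sym[OF edit_step_delete_all[of y]]
  by (rule relpowp_trans)

lemma edit_distance_le: "(edit_step ^^ k) x y \<Longrightarrow> edit_distance x y \<le> k"
  unfolding edit_distance_def by (rule Least_le)

lemma edit_distance_path: "(edit_step ^^ edit_distance x y) x y"
  unfolding edit_distance_def using relpowp_edit_step_replace by (rule LeastI)

lemma edit_distance_le_lengths: "edit_distance x y \<le> length x + length y"
  by (rule edit_distance_le[OF relpowp_edit_step_replace])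

lemma edit_distance_refl [simp]: "edit_distance x x = 0"
  using edit_distance_le[of 0 x x] by simp

lemma edit_distance_commute: "edit_distance x y = edit_distance y x"
  by (meson antisym edit_distance_le edit_distance_path relpowp_edit_step_sym)

lemma edit_distance_triangle: "edit_distance x z \<le> edit_distance x y + edit_distance y z"
  by (rule edit_distance_le) (rule relpowp_trans[OF edit_distance_path edit_distance_path])

lemma edit_distance_context: "edit_distance (p @ x @ s) (p @ y @ s) \<le> edit_distance x y"
  by (rule edit_distance_le) (rule edit_step_context_relpowp[OF edit_distance_path])

text \<open>Replacing a block by deleting one and inserting the other could cost
  \<open>2 * c\<close>. Substituting letters on the common length and then deleting or inserting the
  rest costs only the larger of the two lengths.\<close>

lemma edit_step_concat:
  assumes "edit_step X Y" "\<forall>B\<in>set X \<union> set Y. length B \<le> c"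
  shows "edit_distance (concat X) (concat Y) \<le> c"
  using assms
proof (cases rule: edit_step.cases)
  case (insertion u v a)
  have "edit_distance (concat u @ [] @ concat v) (concat u @ a @ concat v) \<le> c"
    using edit_distance_context[of "concat u" "[]" "concat v" a]
      edit_distance_le_lengths[of "[]" a] assms(2) insertion by simp
  then show ?thesis using insertion by simp
next
  case (deletion u a v)
  have "edit_distance (concat u @ a @ concat v) (concat u @ [] @ concat v) \<le> c"
    using edit_distance_context[of "concat u" a "concat v" "[]"]
      edit_distance_le_lengths[of a "[]"] assms(2) deletion by simp
  then show ?thesis using deletion by simp
next
  case (substitution u a v b)
  have "edit_distance a b \<le> c"
  proof -
    define k where "k = min (length a) (length b)"
    have subst: "(edit_step ^^ length x) x y" if "length x = length y" for x y :: "'a list"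
      using that
    proof (induction x y rule: list_induct2)
      case (Cons x xs y ys)
      have "edit_step (x # xs) (y # xs)" using edit_step.substitution[of "[]" x xs y] by simp
      moreover have "(edit_step ^^ length xs) (y # xs) (y # ys)"
        using edit_step_context_relpowp[OF Cons.IH, of "[y]" "[]"] by simp
      ultimately show ?case by (metis length_Cons relpowp_Suc_I2)
    qed simp
    have "(edit_step ^^ k) (take k a) (take k b)"
      using subst[of "take k a" "take k b"] by (simp add: k_def)
    then have 1: "edit_distance (take k a @ drop k a) (take k b @ drop k a) \<le> k"
      using edit_step_context_relpowp[of k "take k a" "take k b" "[]" "drop k a"]
      by (auto intro: edit_distance_le)
    have "edit_distance (take k b @ drop k a) (take k b @ drop k b)
        \<le> edit_distance (drop k a) (drop k b)"
      using edit_distance_context[of "take k b" "drop k a" "[]" "drop k b"] by simp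
    also have "\<dots> \<le> length (drop k a) + length (drop k b)" by (rule edit_distance_le_lengths)
    finally have "edit_distance a b \<le> k + (length (drop k a) + length (drop k b))"
      using 1 edit_distance_triangle[of a b "take k b @ drop k a"] by simp
    also have "\<dots> \<le> c" using assms(2) substitution by (auto simp: k_def)
    finally show ?thesis .
  qed
  then have "edit_distance (concat u @ a @ concat v) (concat u @ b @ concat v) \<le> c"
    using edit_distance_context order_trans by blast
  then show ?thesis using substitution by simp
qed

lemma edit_distance_concat_le:
  assumes "\<forall>B\<in>set X \<union> set Y. length B \<le> c"
  shows "edit_distance (concat X) (concat Y) \<le> c * edit_distance X Y"
proof -
  \<comment> \<open>An optimal edit path may pass through long blocks; truncating all blocks keeps it a path.\<close>
  have *: "edit_distance (concat (map (take c) X)) (concat (map (take c) Y)) \<le> c * k"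
    if "(edit_step ^^ k) X Y" for k X Y
    using that
  proof (induction k arbitrary: Y)
    case (Suc k)
    then obtain Z where Z: "(edit_step ^^ k) X Z" "edit_step Z Y" by auto
    have "edit_distance (concat (map (take c) Z)) (concat (map (take c) Y)) \<le> c"
      by (rule edit_step_concat[OF edit_step_map[OF Z(2)]]) auto
    then show ?case using Suc.IH[OF Z(1)]
        edit_distance_triangle[of "concat (map (take c) X)" "concat (map (take c) Y)"
          "concat (map (take c) Z)"] by simp
  qed simp
  have "map (take c) X = X" "map (take c) Y = Y" using assms by (auto intro!: map_idI)
  then show ?thesis using *[OF edit_distance_path[of X Y]] by simp
qed

lemma subseq_append_Cons_remove:
  assumes "subseq z (u @ a # v)"
  obtains z' where "subseq z' z" "subseq z' (u @ v)" "length z \<le> length z' + 1"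
proof -
  obtain z1 z2 where z: "z = z1 @ z2" "subseq z1 u" "subseq z2 (a # v)"
    using assms by (auto simp: subseq_append_iff)
  show thesis
  proof (cases "subseq z2 v")
    case True
    then show ?thesis using z by (intro that[of z]) (auto intro: list_emb_append_mono)
  next
    case False
    then obtain z3 where "z2 = a # z3" "subseq z3 v"
      using z(3) by (auto elim: list_emb.cases)
    then show ?thesis using z
      by (intro that[of "z1 @ z3"]) (auto intro: list_emb_append_mono list_emb_Cons)
  qed
qed

text \<open>A shortest edit path may pass through words with repeated letters, to which the
  probability estimates do not apply. A common subsequence gives a detour inside the permutations:
  each edit costs it at most one letter.\<close>

lemma relpowp_edit_step_common_subseq:
  assumes "(edit_step ^^ d) x y"
  shows "\<exists>z. subseq z x \<and> subseq z y \<and> length x \<le> length z + d \<and> length y \<le> length z + d"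
  using assms
proof (induction d arbitrary: y)
  case 0
  then show ?case by auto
next
  case (Suc d)
  then obtain y' where y': "(edit_step ^^ d) x y'" "edit_step y' y" by auto
  from Suc.IH[OF y'(1)] obtain z where z: "subseq z x" "subseq z y'" "length x \<le> length z + d"
    "length y' \<le> length z + d" by auto
  from y'(2) show ?case
  proof cases
    case (insertion u v a)
    have "subseq (u @ v) (u @ a # v)" by (intro list_emb_append_mono list_emb_Cons) auto
    then have "subseq z y" using z(2) insertion subseq_order.order_trans by metis
    then show ?thesis using z insertion by (intro exI[of _ z]) simp
  next
    case (deletion u a v)
    then obtain z' where "subseq z' z" "subseq z' (u @ v)" "length z \<le> length z' + 1"
      using z(2) subseq_append_Cons_remove[of z u a v] by metis
    then show ?thesis using z deletion subseq_order.order_trans[of z' z x]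
      by (intro exI[of _ z']) simp
  next
    case (substitution u a v b)
    then obtain z' where z': "subseq z' z" "subseq z' (u @ v)" "length z \<le> length z' + 1"
      using z(2) subseq_append_Cons_remove[of z u a v] by metis
    have "subseq (u @ v) (u @ b # v)" by (intro list_emb_append_mono list_emb_Cons) auto
    then have "subseq z' y" using z'(2) substitution subseq_order.order_trans by metis
    then show ?thesis using z z' substitution subseq_order.order_trans[of z' z x]
      by (intro exI[of _ z']) simp
  qed
qed


section \<open>The map as a left-to-right scan\<close>

text \<open>The last block is the one still open. As each letter arrives with its marker flag,
  cutting at markers and subdividing happen in one pass; \<open>write_body\<close> performs the same
  step.\<close>

definition grow :: "nat \<Rightarrow> 'a list list \<Rightarrow> 'a \<times> bool \<Rightarrow> 'a list list" where
  "grow c bs p = (if bs = [] \<or> snd p \<or> length (last bs) = c then bs @ [[fst p]]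
     else butlast bs @ [last bs @ [fst p]])"

definition blks :: "nat \<Rightarrow> ('a \<times> bool) list \<Rightarrow> 'a list list" where
  "blks c l = foldl (grow c) [] l"

text \<open>The flags refer to windows in the whole word and are attached before the list is split:
  \<open>blks\<close> can be applied to parts of this list, while \<open>phi\<close> of a subword
  would see other markers.\<close>

definition marked :: "nat \<Rightarrow> ('a \<Rightarrow> nat) \<Rightarrow> 'a list \<Rightarrow> ('a \<times> bool) list" where
  "marked c h w = map (\<lambda>i. (w ! i, marker c h w i)) [0..<length w]"

lemma length_marked [simp]: "length (marked c h w) = length w"
  by (simp add: marked_def)

lemma blks_Nil [simp]: "blks c [] = []"
  by (simp add: blks_def)

lemma blks_snoc: "blks c (l @ [p]) = grow c (blks c l) p"
  by (simp add: blks_def)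

lemma blks_singleton [simp]: "blks c [p] = [[fst p]]"
  by (simp add: blks_def grow_def)

lemma grow_append: "bs \<noteq> [] \<Longrightarrow> grow c (pre @ bs) p = pre @ grow c bs p"
  by (auto simp: grow_def butlast_append)

lemma grow_nonempty [simp]: "grow c bs p \<noteq> []"
  by (simp add: grow_def)

lemma foldl_grow_append: "bs \<noteq> [] \<Longrightarrow> foldl (grow c) (pre @ bs) l = pre @ foldl (grow c) bs l"
  by (induction l arbitrary: bs) (auto simp: grow_append)

text \<open>A flagged letter opens a block whatever came before, so the scan of \<open>l2\<close>
  does not depend on \<open>l1\<close>. This is what resynchronises two words.\<close>

lemma blks_append_marker:
  assumes "l1 = [] \<or> l2 = [] \<or> snd (hd l2)"
  shows "blks c (l1 @ l2) = blks c l1 @ blks c l2"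
proof (cases l2)
  case (Cons p l)
  have "grow c (blks c l1) p = blks c l1 @ grow c [] p"
    using assms Cons by (auto simp: grow_def)
  then show ?thesis using Cons foldl_grow_append[of "grow c [] p" c "blks c l1" l]
    by (simp add: blks_def)
qed simp

lemma chunks_Nil [simp]: "chunks c [] = []"
  by (simp add: chunks.simps)

lemma chunks_eq_Nil_iff: "c > 0 \<Longrightarrow> chunks c w = [] \<longleftrightarrow> w = []"
  by (subst chunks.simps) simp

lemma chunks_short: "c > 0 \<Longrightarrow> w \<noteq> [] \<Longrightarrow> length w \<le> c \<Longrightarrow> chunks c w = [w]"
  by (subst chunks.simps) simp

lemma chunks_snoc:
  assumes "c > 0"
  shows "chunks c (w @ [a]) = grow c (chunks c w) (a, False)"
  using assms
proof (induction c w rule: chunks.induct)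
  case (1 c w)
  consider "w = []" | "w \<noteq> []" "length w < c" | "length w = c" | "length w > c" by linarith
  then show ?case
  proof cases
    case 1
    then show ?thesis using "1.prems" by (simp add: chunks_short grow_def)
  next
    case 2
    then show ?thesis using "1.prems" by (simp add: chunks_short grow_def)
  next
    case 3
    have "chunks c (w @ [a]) = w # chunks c [a]"
      using 3 "1.prems" by (subst chunks.simps) simp
    then show ?thesis using 3 "1.prems" by (auto simp: chunks_short grow_def)
  next
    case 4
    then have ne: "w \<noteq> []" "drop c w \<noteq> []" by auto
    have "chunks c (w @ [a]) = take c w # chunks c (drop c w @ [a])"
      using 4 "1.prems" by (subst chunks.simps) simp
    also have "chunks c (drop c w @ [a]) = grow c (chunks c (drop c w)) (a, False)"
      using 4 "1.prems" ne by (intro "1.IH") auto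
    also have "take c w # \<dots> = grow c (take c w # chunks c (drop c w)) (a, False)"
      using grow_append[of "chunks c (drop c w)" c "[take c w]"] ne "1.prems"
      by (simp add: chunks_eq_Nil_iff)
    also have "take c w # chunks c (drop c w) = chunks c w"
      using 4 "1.prems" ne by (subst (2) chunks.simps) simp
    finally show ?thesis .
  qed
qed

lemma segments_snoc:
  assumes "cs \<noteq> []"
  shows "segments w (cs @ [k]) = segments w cs @ [take (k - last cs) (drop (last cs) w)]"
  using assms
proof (induction cs rule: induct_list012)
  case (3 a b cs)
  then show ?case by (auto simp: segments_def)
qed (auto simp: segments_def)

text \<open>The induction is on the prefix length \<open>k\<close> with \<open>P\<close> fixed,
  because the markers of a prefix, taken as a word of its own, would differ from those of
  \<open>w\<close>.\<close>

lemma concat_chunks_segments: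
  assumes "c > 0" "k \<le> length w"
  shows "concat (map (chunks c) (segments w (0 # filter P [0..<k] @ [k])))
    = blks c (map (\<lambda>i. (w ! i, P i)) [0..<k])"
  using assms(2)
proof (induction k)
  case 0
  then show ?case by (simp add: segments_def)
next
  case (Suc k)
  define cs where "cs = 0 # filter P [0..<k]"
  have last_le: "last cs \<le> k" and last_0: "last cs = k \<Longrightarrow> k = 0"
  proof -
    have "last cs \<in> insert 0 {0..<k}" unfolding cs_def using last_in_set[of "0 # filter P [0..<k]"]
      by auto
    then show "last cs \<le> k" "last cs = k \<Longrightarrow> k = 0" by auto
  qed
  define B where "B = concat (map (chunks c) (segments w cs))"
  define S where "S = take (k - last cs) (drop (last cs) w)"
  have IH: "B @ chunks c S = blks c (map (\<lambda>i. (w ! i, P i)) [0..<k])"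
    using Suc segments_snoc[of cs w k] by (simp add: cs_def B_def S_def)
  have S': "take (Suc k - last cs) (drop (last cs) w) = S @ [w ! k]"
    using last_le Suc.prems by (simp add: S_def Suc_diff_le take_Suc_conv_app_nth)
  show ?case
  proof (cases "P k")
    case True
    have "segments w (0 # filter P [0..<Suc k] @ [Suc k])
        = segments w cs @ [S] @ [take 1 (drop k w)]"
      using True segments_snoc[of "cs @ [k]" w "Suc k"] segments_snoc[of cs w k]
      by (simp add: cs_def S_def)
    moreover have "take 1 (drop k w) = [w ! k]"
      using Suc.prems by (simp add: take_Suc_conv_app_nth)
    ultimately show ?thesis using True IH assms(1)
      by (simp add: B_def blks_snoc grow_def chunks_short)
  next
    case False
    have "segments w (0 # filter P [0..<Suc k] @ [Suc k]) = segments w cs @ [S @ [w ! k]]"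
      using False segments_snoc[of cs w "Suc k"] S' by (simp add: cs_def)
    then have "concat (map (chunks c) (segments w (0 # filter P [0..<Suc k] @ [Suc k])))
        = B @ grow c (chunks c S) (w ! k, False)"
      using assms(1) by (simp add: B_def chunks_snoc)
    also have "\<dots> = grow c (B @ chunks c S) (w ! k, False)"
    \<comment> \<open>If the current segment were empty, \<open>grow\<close> would act on the last
      block of \<open>B\<close> instead. By \<open>last_0\<close> this happens only at the start,
      where \<open>B\<close> is empty too.\<close>
    proof (cases "S = []")
      case True
      then have "k = 0" using last_0 last_le Suc.prems by (simp add: S_def)
      then have "B = []" by (simp add: B_def cs_def segments_def)
      then show ?thesis by simp
    next
      case False
      then show ?thesis using assms(1) by (simp add: grow_append chunks_eq_Nil_iff)
    qed
    finally show ?thesis using False IH by (simp add: blks_snoc)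
  qed
qed

lemma phi_eq_blks: "c > 0 \<Longrightarrow> phi c h w = blks c (marked c h w)"
  using concat_chunks_segments[of c "length w" w "marker c h w"] by (simp add: phi_def marked_def)

lemma grow_length_le:
  assumes "c > 0" "\<forall>B\<in>set bs. length B \<le> c"
  shows "\<forall>B\<in>set (grow c bs p). length B \<le> c"
proof (cases "bs = [] \<or> snd p \<or> length (last bs) = c")
  case False
  then have "length (last bs) < c" using assms(2) last_in_set[of bs] by (metis le_neq_implies_less)
  then show ?thesis using assms(2) False by (auto simp: grow_def dest: in_set_butlastD)
qed (use assms in \<open>auto simp: grow_def\<close>)

lemma blks_length_le: "c > 0 \<Longrightarrow> \<forall>B\<in>set (blks c l). length B \<le> c"
  by (induction l rule: rev_induct) (simp_all add: blks_snoc grow_length_le del: Ball_set)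

lemma concat_blks: "concat (blks c l) = map fst l"
proof (induction l rule: rev_induct)
  case (snoc p l)
  show ?case
  proof (cases "blks c l = []")
    case False
    then have "concat (blks c l) = concat (butlast (blks c l)) @ last (blks c l)"
      by (metis append_butlast_last_id concat_append concat.simps append_Nil2)
    then show ?thesis using snoc by (auto simp: blks_snoc grow_def)
  qed (use snoc in \<open>auto simp: blks_snoc grow_def\<close>)
qed simp

lemma concat_phi: "c > 0 \<Longrightarrow> concat (phi c h w) = w"
  by (simp add: phi_eq_blks concat_blks marked_def comp_def map_nth)

lemma phi_noncontracting:
  assumes "c > 0"
  shows "edit_distance x y \<le> c * edit_distance (phi c h x) (phi c h y)"
proof -
  have "\<forall>B\<in>set (phi c h x) \<union> set (phi c h y). length B \<le> c"
    using assms blks_length_le by (auto simp: phi_eq_blks)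
  from edit_distance_concat_le[OF this] show ?thesis using assms by (simp add: concat_phi)
qed

lemma blks_eq_Nil_iff: "blks c l = [] \<longleftrightarrow> l = []"
  by (cases l rule: rev_cases) (auto simp: blks_snoc)

lemma length_blks_le:
  assumes "c > 0"
  shows "c * length (blks c l) \<le> length l + c * (length (filter snd l) + 1)"
proof -
  \<comment> \<open>The length of the open block acts as a potential: opening a block because the
    last one is full costs \<open>c + 1\<close> but releases \<open>c\<close>, so only markers and
    the first block pay an extra \<open>c\<close>.\<close>
  have "l \<noteq> [] \<Longrightarrow> c * length (blks c l) + length (last (blks c l))
      \<le> length l + c * (length (filter snd l) + 1)"
  proof (induction l rule: rev_induct)
    case (snoc p l)
    show ?case
    proof (cases "l = []")
      case False
      then show ?thesis using snoc assms
        by (auto simp: blks_snoc grow_def algebra_simps blks_eq_Nil_iff)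
    qed (use assms in \<open>auto simp: blks_snoc grow_def\<close>)
  qed simp
  then show ?thesis by (cases "l = []") auto
qed

text \<open>At distance at most \<open>c\<close> each would lie in the window of the other and have
  the strictly smaller hash.\<close>

lemma marker_separated:
  assumes "marker c h w i" "marker c h w j" "i < j"
  shows "i + c < j"
proof (rule ccontr)
  assume "\<not> i + c < j"
  then have "j \<in> {i - c..i + c} - {i}" "i \<in> {j - c..j + c} - {j}" using assms(3) by auto
  then have "h (w ! i) < h (w ! j)" "h (w ! j) < h (w ! i)"
    using assms unfolding marker_def by blast+
  then show False by simp
qed

text \<open>By separation \<open>i div c\<close> is injective on markers, and it takes at most
  \<open>(b - a) div c + 2\<close> values. The range is arbitrary so that the bound applies to the
  stretch around a deletion.\<close>

lemma number_of_markers_le: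
  assumes "c > 0" "a \<le> b"
  shows "c * length (filter (marker c h w) [a..<b]) \<le> (b - a) + 2 * c"
proof -
  let ?S = "{i \<in> {a..<b}. marker c h w i}"
  have "inj_on (\<lambda>i. i div c) ?S"
  proof (rule inj_onI, rule ccontr)
    fix i j assume ij: "i \<in> ?S" "j \<in> ?S" "i div c = j div c" "i \<noteq> j"
    have *: "i' div c \<noteq> j' div c" if "i' + c < j'" for i' j'
      using that assms(1) div_le_mono[of "i' + c" j' c] by simp
    have "i + c < j \<or> j + c < i"
      using ij marker_separated[of c h w] by (metis (mono_tags, lifting) linorder_neqE_nat mem_Collect_eq)
    then show False using *[of i j] *[of j i] ij(3) by auto
  qed
  then have "card ?S \<le> card {a div c..b div c}"
    by (rule card_inj_on_le) (auto simp: div_le_mono)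
  also have "\<dots> \<le> (b - a) div c + 2"
  proof -
    have "b div c \<le> a div c + (b - a) div c + 1"
    proof -
      have "(a mod c + (b - a) mod c) div c \<le> 1"
        using assms(1) mod_less_divisor[of c a] mod_less_divisor[of c "b - a"]
          div_less_iff_less_mult[of c "a mod c + (b - a) mod c" 2] by linarith
      then show ?thesis using assms div_add1_eq[of a "b - a" c] by simp
    qed
    then show ?thesis by simp
  qed
  finally have "c * card ?S \<le> c * ((b - a) div c + 2)" by (rule mult_le_mono2)
  also have "\<dots> \<le> (b - a) + 2 * c"
    using times_div_less_eq_dividend[of c "b - a"] by (simp add: add_mult_distrib2)
  finally have "c * card ?S \<le> (b - a) + 2 * c" .
  moreover have "length (filter (marker c h w) [a..<b]) = card ?S"
    using distinct_card[of "filter (marker c h w) [a..<b]"] by (simp add: atLeastLessThan_def Int_def conj_commute)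
  ultimately show ?thesis by simp
qed

lemma length_phi_le:
  assumes "c > 0"
  shows "c * length (phi c h w) \<le> 2 * length w + 3 * c"
  using length_blks_le[OF assms, of "marked c h w"]
    number_of_markers_le[OF assms, of 0 "length w" h w] assms
  by (simp add: phi_eq_blks marked_def filter_map comp_def algebra_simps)

section \<open>Effect of one deletion on the blocks\<close>

lemma marker_append_left:
  assumes "i + c < length u"
  shows "marker c h (u @ v) i = marker c h u i"
  using assms unfolding marker_def by (auto simp: nth_append)

lemma marker_append_right:
  assumes "c \<le> i"
  shows "marker c h (p @ v) (length p + i) = marker c h v i"
proof -
  have "{length p + i - c..length p + i + c} - {length p + i}
      = (+) (length p) ` ({i - c..i + c} - {i})"
    using assms by (auto simp: image_set_diff)
  then show ?thesis using assms unfolding marker_def by auto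
qed

text \<open>The windows of the markers \<open>i\<close> and \<open>j\<close> avoid the deleted
  letter, so both words have these markers and both scans restart there; \<open>i = 0\<close> and
  \<open>j\<close> at the end stand in for missing markers. The two middle stretches are compared
  through their numbers of blocks alone, \<open>c\<close> times which is at most
  \<open>2 * (j - i) + 3 * c\<close> for each.\<close>

lemma phi_deletion_bound:
  fixes u v :: "'a list"
  assumes "c > 0"
    and left: "i \<le> length u" "i = 0 \<or> marker c h (u @ a # v) i \<and> i + c < length u"
    and right: "length u < j" "j \<le> length (u @ a # v)"
      "j = length (u @ a # v) \<or> marker c h (u @ a # v) j \<and> length u + c < j"
  shows "c * edit_distance (phi c h (u @ a # v)) (phi c h (u @ v)) \<le> 4 * (j - i) + 6 * c"
proof -
  define x where "x = u @ a # v"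
  define y where "y = u @ v"
  define f where "f w i = (w ! i, marker c h w i)" for w i
  have marked: "marked c h w = map (f w) [0..<k] @ map (f w) [k..<l] @ map (f w) [l..<length w]"
    if "k \<le> l" "l \<le> length w" for k l w
    unfolding marked_def f_def map_append[symmetric]
    using that upt_add_eq_append[of 0 k "length w - k"] upt_add_eq_append[of k l "length w - l"]
    by simp
  have split: "phi c h w = blks c (map (f w) [0..<k]) @ blks c (map (f w) [k..<l])
      @ blks c (map (f w) [l..<length w])"
    if "k \<le> l" "l \<le> length w" "k = 0 \<or> k < l \<and> marker c h w k" "l = length w \<or> marker c h w l"
    for k l w
  proof -
    have "blks c ((map (f w) [0..<k] @ map (f w) [k..<l]) @ map (f w) [l..<length w])
        = blks c (map (f w) [0..<k] @ map (f w) [k..<l]) @ blks c (map (f w) [l..<length w])"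
      using that by (intro blks_append_marker) (auto simp: f_def upt_conv_Cons hd_map)
    also have "blks c (map (f w) [0..<k] @ map (f w) [k..<l])
        = blks c (map (f w) [0..<k]) @ blks c (map (f w) [k..<l])"
      using that by (intro blks_append_marker) (auto simp: f_def upt_conv_Cons hd_map)
    finally show ?thesis using that marked[of k l w] assms(1) by (simp add: phi_eq_blks)
  qed
  have mid: "c * length (blks c (map (f w) [k..<l])) \<le> 2 * (l - k) + 3 * c" if "k \<le> l" for k l w
    using length_blks_le[OF assms(1), of "map (f w) [k..<l]"]
      number_of_markers_le[OF assms(1) that, of h w]
    by (simp add: filter_map comp_def f_def algebra_simps)
  have lens: "length x = length u + length v + 1" "length y = length u + length v"
    by (auto simp: x_def y_def)
  have before: "f x k = f y k" if "k + c < length u" for k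
    using that marker_append_left[of k c u h "a # v"] marker_append_left[of k c u h v]
    by (simp add: f_def x_def y_def nth_append)
  have after: "f x (Suc k) = f y k" if "length u + c \<le> k" for k
  proof -
    have "marker c h x (Suc k) = marker c h v (k - length u)"
      using that marker_append_right[of c "k - length u" h "u @ [a]" v] by (simp add: x_def)
    moreover have "marker c h y k = marker c h v (k - length u)"
      using that marker_append_right[of c "k - length u" h u v] by (simp add: y_def)
    ultimately show ?thesis using that by (simp add: f_def x_def y_def nth_append nth_Cons')
  qed
  have px: "map (f x) [0..<i] = map (f y) [0..<i]"
    using left before by auto
  \<comment> \<open>Behind the deleted letter the positions of \<open>y\<close> lag by one:
    \<open>j\<close> in \<open>x\<close> is \<open>j - 1\<close> in \<open>y\<close>.\<close>
  have sx: "map (f x) [j..<length x] = map (f y) [j - 1..<length y]"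
  proof (cases "j = length x")
    case False
    then have "map (f x) [Suc (j - 1)..<Suc (length y)] = map (f y) [j - 1..<length y]"
      using right after unfolding map_Suc_upt[symmetric] map_map comp_def
      by (intro map_cong) (auto simp: x_def)
    then show ?thesis using right(1) lens by simp
  qed (use lens in auto)
  have "phi c h x = blks c (map (f x) [0..<i]) @ blks c (map (f x) [i..<j])
      @ blks c (map (f x) [j..<length x])"
    using left right by (intro split) (auto simp: x_def)
  moreover have "phi c h y = blks c (map (f y) [0..<i]) @ blks c (map (f y) [i..<j - 1])
      @ blks c (map (f y) [j - 1..<length y])"
  proof (rule split)
    show "i = 0 \<or> i < j - 1 \<and> marker c h y i"
      using left right before[of i] by (auto simp: f_def x_def)
    show "j - 1 = length y \<or> marker c h y (j - 1)"
    proof (cases "j = length x")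
      case False
      then have "length u + c \<le> j - 1" "Suc (j - 1) = j" "marker c h x j"
        using right by (auto simp: x_def)
      then show ?thesis using after[of "j - 1"] by (auto simp: f_def)
    qed (use lens in simp)
  qed (use left right lens in \<open>auto simp: x_def\<close>)
  ultimately have "edit_distance (phi c h x) (phi c h y)
      \<le> edit_distance (blks c (map (f x) [i..<j])) (blks c (map (f y) [i..<j - 1]))"
    using px sx edit_distance_context by metis
  also have "\<dots> \<le> length (blks c (map (f x) [i..<j])) + length (blks c (map (f y) [i..<j - 1]))"
    by (rule edit_distance_le_lengths)
  finally have "c * edit_distance (phi c h x) (phi c h y)
      \<le> c * length (blks c (map (f x) [i..<j])) + c * length (blks c (map (f y) [i..<j - 1]))"
    by (metis add_mult_distrib2 mult_le_mono2)
  also have "\<dots> \<le> (2 * (j - i) + 3 * c) + (2 * (j - 1 - i) + 3 * c)"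
    using left right by (intro add_mono mid) auto
  also have "\<dots> \<le> 4 * (j - i) + 6 * c" by simp
  finally show ?thesis by (simp add: x_def y_def)
qed

section \<open>Probability of long distances\<close>

text \<open>The sum is an upper sum for the integral of \<open>t ^ k\<close> from \<open>0\<close>
  to \<open>N - 1\<close>. Bernoulli supplies
  \<open>N ^ (k + 1) - (N - 1) ^ (k + 1) <= (k + 1) * N ^ k\<close> for the induction.\<close>

lemma sum_powers_ge:
  assumes "N \<ge> 1"
  shows "(real N - 1) ^ Suc k \<le> real (Suc k) * (\<Sum>u<N. real u ^ k)"
  using assms
proof (induction N rule: nat_induct_at_least)
  case (Suc N)
  have "1 + real (Suc k) * (- 1 / real N) \<le> (1 + (- 1 / real N)) ^ Suc k"
    by (rule Bernoulli_inequality) (use Suc.hyps in auto)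
  then have "real N ^ Suc k * (1 + real (Suc k) * (- 1 / real N))
      \<le> real N ^ Suc k * (1 + (- 1 / real N)) ^ Suc k"
    by (rule mult_left_mono) simp
  also have "\<dots> = (real N - 1) ^ Suc k"
  proof -
    have "real N * (1 + (- 1 / real N)) = real N - 1" using Suc.hyps by (simp add: right_diff_distrib)
    then show ?thesis by (simp only: power_mult_distrib[symmetric])
  qed
  also have "real N ^ Suc k * (1 + real (Suc k) * (- 1 / real N))
      = real N ^ Suc k - real (Suc k) * real N ^ k"
    using Suc.hyps by (simp add: field_simps)
  finally show ?case using Suc.IH by (simp add: algebra_simps)
qed simp

lemma prob_hash_value:
  assumes "k_wise_indep_family n A l H" "a \<in> A"
  shows "measure_pmf.prob H {h. h a \<in> S} = real (card ({..<2 ^ l} \<inter> S)) / 2 ^ l"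
proof -
  have "measure_pmf.prob H {h. h a \<in> S} = measure_pmf.prob (map_pmf (\<lambda>h. h a) H) S"
    by (simp add: vimage_def)
  also have "\<dots> = real (card ({..<2 ^ l} \<inter> S)) / 2 ^ l"
  proof -
    have "map_pmf (\<lambda>h. h a) H = pmf_of_set {..<2 ^ l}"
      using assms by (simp add: k_wise_indep_family_def)
    moreover have "{..<2 ^ l :: nat} \<noteq> {}" by (simp add: lessThan_empty_iff)
    ultimately show ?thesis by (simp add: measure_pmf_of_set)
  qed
  finally show ?thesis .
qed

lemma hash_less:
  assumes "k_wise_indep_family n A l H" "h \<in> set_pmf H" "a \<in> A"
  shows "h a < 2 ^ l"
proof -
  have "h a \<in> set_pmf (map_pmf (\<lambda>h. h a) H)" using assms(2) by auto
  also have "map_pmf (\<lambda>h. h a) H = pmf_of_set {..<2 ^ l}"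
    using assms by (simp add: k_wise_indep_family_def)
  finally show ?thesis by (simp add: set_pmf_of_set lessThan_empty_iff)
qed

text \<open>Without collisions the probability would be \<open>1 / card J\<close> by symmetry.
  Splitting by the value \<open>v\<close> of \<open>h i\<close>, each case has probability
  \<open>(N - 1 - v) ^ (card J - 1) / N ^ card J\<close>; bounding the sum over \<open>v\<close>
  loses only the factor \<open>((N - 1) / N) ^ card J\<close>.\<close>

lemma prob_unique_min_ge:
  fixes J :: "'a set" and l :: nat
  defines "N \<equiv> 2 ^ l :: nat"
  assumes fam: "k_wise_indep_family n A l H"
    and J: "J \<subseteq> A" "finite J" "card J \<le> n" "i \<in> J"
  shows "((real N - 1) / real N) ^ card J / real (card J)
    \<le> measure_pmf.prob H {h. \<forall>j\<in>J - {i}. h i < h j}"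
proof -
  define K where "K = card J - 1"
  have K: "card J = Suc K" "card (J - {i}) = K"
    using J card_gt_0_iff[of J] by (auto simp: K_def)
  have N: "N \<ge> 1" by (simp add: N_def)
  define Y where "Y v j = (if j = i then {v} else {v<..})" for v :: nat and j
  define E where "E v = (\<Inter>j\<in>J. (\<lambda>h. h j) -` Y v j)" for v
  have E_prob: "measure_pmf.prob H (E v) = (real (N - Suc v) ^ K) / real N ^ Suc K"
    if "v < N" for v
  proof -
    have "prob_space.indep_vars (measure_pmf H) (\<lambda>_. count_space UNIV) (\<lambda>a h. h a) J"
      using fam J by (auto simp: k_wise_indep_family_def)
    then have "measure_pmf.prob H (\<Inter>j\<in>J. (\<lambda>h. h j) -` Y v j \<inter> space (measure_pmf H))
        = (\<Prod>j\<in>J. measure_pmf.prob H ((\<lambda>h. h j) -` Y v j \<inter> space (measure_pmf H)))"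
      using J by (intro prob_space.indep_varsD[OF prob_space_measure_pmf,
          where M' = "\<lambda>_. count_space UNIV" and I = J]) auto
    then have "measure_pmf.prob H (E v) = (\<Prod>j\<in>J. measure_pmf.prob H {h. h j \<in> Y v j})"
      by (simp add: E_def vimage_def)
    also have "\<dots> = (\<Prod>j\<in>J. real (card ({..<N} \<inter> Y v j)) / real N)"
      using J fam by (intro prod.cong) (auto simp: prob_hash_value N_def)
    also have "\<dots> = real (card ({..<N} \<inter> Y v i)) / real N
        * (\<Prod>j\<in>J - {i}. real (card ({..<N} \<inter> Y v j)) / real N)"
      using J by (simp add: prod.remove)
    also have "(\<Prod>j\<in>J - {i}. real (card ({..<N} \<inter> Y v j)) / real N)
        = (\<Prod>j\<in>J - {i}. real (N - Suc v) / real N)"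
    proof (rule prod.cong)
      have "{..<N} \<inter> {v<..} = {Suc v..<N}" by auto
      then show "real (card ({..<N} \<inter> Y v j)) / real N = real (N - Suc v) / real N"
        if "j \<in> J - {i}" for j
        using that by (auto simp: Y_def)
    qed simp
    also have "\<dots> = (real (N - Suc v) / real N) ^ K" by (simp add: K)
    also have "{..<N} \<inter> Y v i = {v}" using that by (auto simp: Y_def)
    finally show ?thesis by (simp add: power_divide)
  qed
  have "(real N - 1) ^ Suc K \<le> real (Suc K) * (\<Sum>u<N. real u ^ K)"
    by (rule sum_powers_ge[OF N])
  then have "((real N - 1) / real N) ^ card J / real (card J)
      \<le> (\<Sum>u<N. real u ^ K) / real N ^ Suc K"
    using N by (simp add: K power_divide divide_simps mult_ac del: power_Suc of_nat_Suc)
  also have "(\<Sum>u<N. real u ^ K) = (\<Sum>v<N. real (N - Suc v) ^ K)"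
    by (rule sum.nat_diff_reindex[symmetric])
  also have "\<dots> / real N ^ Suc K = (\<Sum>v<N. measure_pmf.prob H (E v))"
    unfolding sum_divide_distrib by (intro sum.cong) (auto simp: E_prob)
  also have "\<dots> = measure_pmf.prob H (\<Union>v<N. E v)"
  proof (rule measure_pmf.finite_measure_finite_Union[symmetric])
    show "disjoint_family_on E {..<N}"
      using J unfolding disjoint_family_on_def E_def Y_def by fastforce
  qed auto
  also have "\<dots> \<le> measure_pmf.prob H {h. \<forall>j\<in>J - {i}. h i < h j}"
  proof (intro measure_pmf.finite_measure_mono)
    show "(\<Union>v<N. E v) \<subseteq> {h. \<forall>j\<in>J - {i}. h i < h j}"
    proof (intro subsetI CollectI ballI)
      fix h j assume h: "h \<in> (\<Union>v<N. E v)" and j: "j \<in> J - {i}"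
      then obtain v where "\<forall>j\<in>J. h j \<in> Y v j" by (auto simp: E_def)
      then have "h i \<in> Y v i" "h j \<in> Y v j" using J(4) j by auto
      then show "h i < h j" using j by (auto simp: Y_def)
    qed
  qed simp
  finally show ?thesis .
qed

text \<open>The letter of minimal hash in a window of length \<open>4 * c\<close> is a marker as soon as it lies in
  the middle half, whatever surrounds the window.\<close>

definition good_window :: "nat \<Rightarrow> ('a \<Rightarrow> nat) \<Rightarrow> 'a list \<Rightarrow> nat \<Rightarrow> bool" where
  "good_window c h w s \<longleftrightarrow>
     (\<exists>i\<in>{s + c..<s + 3 * c}. \<forall>j\<in>{s..<s + 4 * c} - {i}. h (w ! i) < h (w ! j))"

text \<open>Only the hashes of the letters in the window matter, which makes disjoint windows
  independent.\<close>

lemma good_window_cong: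
  assumes "\<And>i. i \<in> {s..<s + 4 * c} \<Longrightarrow> f (w ! i) = g (w ! i)"
  shows "good_window c f w s = good_window c g w s"
  unfolding good_window_def using assms by (intro bex_cong ball_cong) auto

lemma good_window_marker:
  assumes "good_window c h w s" "s + 4 * c \<le> length w"
  obtains i where "s + c \<le> i" "i < s + 3 * c" "marker c h w i"
proof -
  from assms obtain i where i: "i \<in> {s + c..<s + 3 * c}"
    "\<forall>j\<in>{s..<s + 4 * c} - {i}. h (w ! i) < h (w ! j)"
    by (auto simp: good_window_def)
  have "{i - c..i + c} \<subseteq> {s..<s + 4 * c}" using i(1) by auto
  then have "marker c h w i" using i assms(2) unfolding marker_def by auto
  then show thesis using that i by auto
qed

text \<open>Each of the \<open>2 * c\<close> positions of the middle half is the unique minimum with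
  probability at least \<open>1 / 2 * (1 / (4 * c))\<close>, and these events are disjoint. The
  first factor is the loss by collisions:
  \<open>(1 - 1 / N) ^ (4 * c) >= 1 - 4 * c / N >= 1 / 2\<close> as
  \<open>8 * c <= N\<close>.\<close>

lemma prob_good_window_ge:
  assumes fam: "k_wise_indep_family n A l H" and w: "w \<in> perms_le n A"
    and c: "c > 0" "8 * c \<le> 2 ^ l" and s: "s + 4 * c \<le> length w"
  shows "measure_pmf.prob H {h. good_window c h w s} \<ge> 1 / 4"
proof -
  define N :: real where "N = 2 ^ l"
  have w': "set w \<subseteq> A" "distinct w" "length w \<le> n" using w by (auto simp: perms_le_def)
  have cN: "8 * real c \<le> N" using c(2) unfolding N_def
    by (metis of_nat_le_iff of_nat_mult of_nat_numeral of_nat_power)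
  define J where "J = (!) w ` {s..<s + 4 * c}"
  have inj: "inj_on ((!) w) {s..<s + 4 * c}"
    using w'(2) s by (auto simp: inj_on_def nth_eq_iff_index_eq)
  have J: "J \<subseteq> A" "finite J" "card J = 4 * c"
    using w' s by (auto simp: J_def card_image[OF inj] intro: subsetD[OF w'(1)])
  define E where "E i = {h. \<forall>j\<in>{s..<s + 4 * c} - {i}. h (w ! i) < (h (w ! j) :: nat)}" for i
  have E: "((N - 1) / N) ^ (4 * c) / real (4 * c) \<le> measure_pmf.prob H (E i)"
    if "i \<in> {s..<s + 4 * c}" for i
  proof -
    have "J - {w ! i} = (!) w ` ({s..<s + 4 * c} - {i})"
      using that inj by (auto simp: J_def inj_on_def)
    then have "E i = {h. \<forall>a\<in>J - {w ! i}. h (w ! i) < h a}" by (simp add: E_def)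
    then show ?thesis
      using prob_unique_min_ge[OF fam J(1,2), of "w ! i"] J(3) that w'(3) s
      by (simp add: N_def J_def)
  qed
  have "1 / 2 \<le> 1 + real (4 * c) * (- 1 / N)" using cN c(1) by (simp add: field_simps)
  also have "\<dots> \<le> (1 + (- 1 / N)) ^ (4 * c)"
    using cN c(1) by (intro Bernoulli_inequality) (simp add: field_simps)
  also have "1 + (- 1 / N) = (N - 1) / N" using cN c(1) by (simp add: field_simps)
  finally have "1 / 4 \<le> (2 * real c) * (((N - 1) / N) ^ (4 * c) / real (4 * c))"
    using c(1) by simp
  also have "\<dots> = (\<Sum>i\<in>{s + c..<s + 3 * c}. ((N - 1) / N) ^ (4 * c) / real (4 * c))" by simp
  also have "\<dots> \<le> (\<Sum>i\<in>{s + c..<s + 3 * c}. measure_pmf.prob H (E i))"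
    by (intro sum_mono E) auto
  also have "\<dots> = measure_pmf.prob H (\<Union>i\<in>{s + c..<s + 3 * c}. E i)"
  proof (rule measure_pmf.finite_measure_finite_Union[symmetric])
    show "disjoint_family_on E {s + c..<s + 3 * c}"
    proof (unfold disjoint_family_on_def, intro ballI impI)
      fix i j assume ij: "i \<in> {s + c..<s + 3 * c}" "j \<in> {s + c..<s + 3 * c}" "i \<noteq> j"
      then have "j \<in> {s..<s + 4 * c} - {i}" "i \<in> {s..<s + 4 * c} - {j}" by auto
      then show "E i \<inter> E j = {}" unfolding E_def using less_asym by blast
    qed
  qed auto
  also have "(\<Union>i\<in>{s + c..<s + 3 * c}. E i) = {h. good_window c h w s}"
    by (auto simp: E_def good_window_def)
  finally show ?thesis .
qed

lemma prob_no_good_window_le: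
  assumes fam: "k_wise_indep_family n A l H" and w: "w \<in> perms_le n A"
    and c: "c > 0" "8 * c \<le> 2 ^ l" and r: "r + 4 * c * t \<le> length w"
  shows "measure_pmf.prob H {h. \<forall>k<t. \<not> good_window c h w (r + 4 * c * k)} \<le> (3 / 4) ^ t"
proof (cases "t = 0")
  case False
  have w': "set w \<subseteq> A" "distinct w" "length w \<le> n" using w by (auto simp: perms_le_def)
  define I where "I k = {r + 4 * c * k..<r + 4 * c * k + 4 * c}" for k
  define J where "J k = (!) w ` I k" for k
  define bad where "bad k f \<longleftrightarrow> \<not> good_window c f w (r + 4 * c * k)" for k and f :: "'a \<Rightarrow> nat"
  have fits: "r + 4 * c * k + 4 * c \<le> length w" if "k < t" for k
  proof -
    have "4 * c * k + 4 * c \<le> 4 * c * t"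
      using mult_le_mono2[of "Suc k" t "4 * c"] that by simp
    then show ?thesis using r by linarith
  qed
  have J: "J k \<subseteq> set w" if "k < t" for k
    using fits[OF that] by (auto simp: J_def I_def)
  have I_disj: "I k \<inter> I k' = {}" if "k < k'" for k k'
  proof -
    have "4 * c * k + 4 * c \<le> 4 * c * k'"
      using mult_le_mono2[of "Suc k" k' "4 * c"] that by simp
    then show ?thesis by (auto simp: I_def)
  qed
  \<comment> \<open>Since the letters of \<open>w\<close> are distinct, disjoint index windows have
    disjoint sets of letters, so their groups of hash values are independent.\<close>
  have disj: "disjoint_family_on J {..<t}"
  proof (unfold disjoint_family_on_def, intro ballI impI)
    fix k k' assume k: "k \<in> {..<t}" "k' \<in> {..<t}" "k \<noteq> k'"
    have "I k \<inter> I k' = {}" using I_disj[of k k'] I_disj[of k' k] k(3) by (auto simp: neq_iff)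
    moreover have "I k \<subseteq> {..<length w}" "I k' \<subseteq> {..<length w}"
      using fits[of k] fits[of k'] k by (auto simp: I_def)
    ultimately show "J k \<inter> J k' = {}"
      using w'(2) unfolding J_def by (force simp: nth_eq_iff_index_eq)
  qed
  have "prob_space.indep_vars (measure_pmf H) (\<lambda>_. count_space UNIV) (\<lambda>a h. h a) (set w)"
    using fam w' distinct_card[of w] by (auto simp: k_wise_indep_family_def)
  then have "prob_space.indep_vars (measure_pmf H) (\<lambda>k. PiM (J k) (\<lambda>_. count_space UNIV))
      (\<lambda>k h. restrict (\<lambda>a. h a) (J k)) {..<t}"
    using J disj by (intro prob_space.indep_vars_restrict[OF prob_space_measure_pmf]) auto
  \<comment> \<open>\<open>J k\<close> is finite and hash values are countable, so the product
    sigma-algebra is discrete and every predicate is measurable.\<close>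
  moreover have "bad k \<in> measurable (PiM (J k) (\<lambda>_. count_space UNIV)) (count_space UNIV)" for k
  proof -
    have "PiM (J k) (\<lambda>_. count_space (UNIV :: nat set)) = count_space (PiE (J k) (\<lambda>_. UNIV))"
      by (rule count_space_PiM_finite) (auto simp: J_def I_def)
    then show ?thesis by (simp only: measurable_count_space_eq1) simp
  qed
  ultimately have "prob_space.indep_vars (measure_pmf H) (\<lambda>k. count_space UNIV)
      (\<lambda>k h. bad k (restrict (\<lambda>a. h a) (J k))) {..<t}"
    by (intro prob_space.indep_vars_compose2[OF prob_space_measure_pmf, where Y = bad])
  moreover have "bad k (restrict (\<lambda>a. h a) (J k)) = bad k h" for k h
    unfolding bad_def by (intro arg_cong[of _ _ Not] good_window_cong) (simp add: J_def I_def)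
  ultimately have "prob_space.indep_vars (measure_pmf H) (\<lambda>k. count_space UNIV) bad {..<t}"
    by simp
  then have "measure_pmf.prob H (\<Inter>k\<in>{..<t}. bad k -` {True} \<inter> space (measure_pmf H))
      = (\<Prod>k<t. measure_pmf.prob H (bad k -` {True} \<inter> space (measure_pmf H)))"
    using False by (intro prob_space.indep_varsD[OF prob_space_measure_pmf,
          where M' = "\<lambda>_. count_space UNIV" and I = "{..<t}"]) auto
  also have "\<dots> \<le> (\<Prod>k<t. 3 / 4)"
  proof (rule prod_mono, rule conjI)
    fix k assume k: "k \<in> {..<t}"
    let ?G = "{h. good_window c h w (r + 4 * c * k)}"
    have eq: "bad k -` {True} \<inter> space (measure_pmf H) = space (measure_pmf H) - ?G"
      unfolding bad_def vimage_def by fastforce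
    have "measure_pmf.prob H (space (measure_pmf H) - ?G) = 1 - measure_pmf.prob H ?G"
      by (rule measure_pmf.prob_compl) simp
    moreover have "r + 4 * c * k + 4 * c \<le> length w" using fits k by simp
    then have "1 / 4 \<le> measure_pmf.prob H ?G" by (rule prob_good_window_ge[OF fam w c])
    ultimately show "measure_pmf.prob H (bad k -` {True} \<inter> space (measure_pmf H)) \<le> 3 / 4"
      unfolding eq by linarith
  qed (rule measure_nonneg)
  also have "(\<Prod>k<t. 3 / 4 :: real) = (3 / 4) ^ t" by simp
  also have "(\<Inter>k\<in>{..<t}. bad k -` {True} \<inter> space (measure_pmf H))
      = {h. \<forall>k<t. \<not> good_window c h w (r + 4 * c * k)}"
    using False unfolding bad_def vimage_def by fastforce
  finally show ?thesis .
qed simp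

text \<open>If on each side one of the \<open>t\<close> nearest windows is good, then
  \<open>j - i <= 8 * c * t + 1\<close> in \<open>phi_deletion_bound\<close>, and
  \<open>4 * (j - i) + 6 * c <= c * (32 * t + 10)\<close>. A side without room for \<open>t\<close>
  windows uses the end of the word. For \<open>n < 4 * c\<close> no window fits, so a large hash
  range is only asked for otherwise.\<close>

lemma prob_phi_deletion_gt_le:
  fixes u v :: "'a list" and c n :: nat
  assumes fam: "k_wise_indep_family n A l H" and x: "u @ a # v \<in> perms_le n A"
    and c: "c > 0" "4 * c \<le> n \<longrightarrow> 8 * c \<le> 2 ^ l"
  shows "measure_pmf.prob H
      {h. edit_distance (phi c h (u @ a # v)) (phi c h (u @ v)) > 32 * t + 10} \<le> 2 * (3 / 4) ^ t"
    (is "measure_pmf.prob H ?E \<le> _")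
proof (cases "t = 0")
  case True
  then show ?thesis by (auto intro: order_trans[OF measure_pmf.prob_le_1])
next
  case t: False
  define x where "x = u @ a # v"
  have len: "length x \<le> n" "length u < length x" using x by (auto simp: x_def perms_le_def)
  define none where "none r = (if r + 4 * c * t \<le> length x
    then {h. \<forall>k<t. \<not> good_window c h x (r + 4 * c * k)} else {})" for r
  have none: "measure_pmf.prob H (none r) \<le> (3 / 4) ^ t" for r
  proof (cases "r + 4 * c * t \<le> length x")
    case True
    have "4 * c \<le> 4 * c * t" using t by simp
    then have "4 * c \<le> n" using True len by linarith
    then show ?thesis using prob_no_good_window_le[OF fam x c(1), of r t] c(2) True
      by (simp add: none_def x_def)
  qed (simp add: none_def)
  have some_marker: "\<exists>k i. k < t \<and> r + 4 * c * k + c \<le> i \<and> i < r + 4 * c * k + 3 * c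
      \<and> r + 4 * c * k + 4 * c \<le> r + 4 * c * t \<and> marker c h x i"
    if "h \<notin> none r" "r + 4 * c * t \<le> length x" for h r
  proof -
    from that obtain k where k: "k < t" "good_window c h x (r + 4 * c * k)"
      by (auto simp: none_def)
    have "4 * c * k + 4 * c \<le> 4 * c * t"
      using mult_le_mono2[of "Suc k" t "4 * c"] k(1) by simp
    then have le: "r + 4 * c * k + 4 * c \<le> r + 4 * c * t" by simp
    with good_window_marker[OF k(2)] that(2) k(1) show ?thesis by (metis le_trans)
  qed
  \<comment> \<open>Without the guard, truncated subtraction would start the windows at
    \<open>0\<close> and let them reach over the deleted letter.\<close>
  define L where "L = (if 4 * c * t \<le> length u then none (length u - 4 * c * t) else {})"
  have "?E \<subseteq> L \<union> none (length u + 1)"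
  proof (rule subsetI, rule ccontr)
    fix h assume h: "h \<in> ?E" "h \<notin> L \<union> none (length u + 1)"
    have "\<exists>i. i \<le> length u \<and> length u \<le> i + 4 * c * t
        \<and> (i = 0 \<or> marker c h x i \<and> i + c < length u)"
    proof (cases "4 * c * t \<le> length u")
      case True
      then have r: "length u - 4 * c * t + 4 * c * t = length u" by simp
      have "\<exists>k i. k < t \<and> length u - 4 * c * t + 4 * c * k + c \<le> i
          \<and> i < length u - 4 * c * t + 4 * c * k + 3 * c
          \<and> length u - 4 * c * t + 4 * c * k + 4 * c \<le> length u - 4 * c * t + 4 * c * t
          \<and> marker c h x i"
        by (rule some_marker) (use True h(2) len in \<open>auto simp: L_def\<close>)
      then obtain k i where ki: "length u - 4 * c * t + 4 * c * k + c \<le> i"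
        "i < length u - 4 * c * t + 4 * c * k + 3 * c"
        "length u - 4 * c * t + 4 * c * k + 4 * c \<le> length u" "marker c h x i"
        unfolding r by blast
      then show ?thesis by (intro exI[of _ i]) auto
    qed auto
    then obtain i where i: "i \<le> length u" "length u \<le> i + 4 * c * t"
      "i = 0 \<or> marker c h x i \<and> i + c < length u" by blast
    have "\<exists>j. length u < j \<and> j \<le> length x \<and> j \<le> length u + 1 + 4 * c * t
        \<and> (j = length x \<or> marker c h x j \<and> length u + c < j)"
    proof (cases "length u + 1 + 4 * c * t \<le> length x")
      case True
      then obtain k j where kj: "length u + 1 + 4 * c * k + c \<le> j"
        "j < length u + 1 + 4 * c * k + 3 * c"
        "length u + 1 + 4 * c * k + 4 * c \<le> length u + 1 + 4 * c * t" "marker c h x j"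
        using some_marker[of h "length u + 1"] h(2) by blast
      then show ?thesis using True by (intro exI[of _ j]) linarith
    qed (use len in auto)
    then obtain j where j: "length u < j" "j \<le> length x" "j \<le> length u + 1 + 4 * c * t"
      "j = length x \<or> marker c h x j \<and> length u + c < j" by blast
    have "c * edit_distance (phi c h x) (phi c h (u @ v)) \<le> 4 * (j - i) + 6 * c"
      using phi_deletion_bound[OF c(1), of i u h a v j] i j by (simp add: x_def)
    also have "\<dots> \<le> 4 * (8 * c * t + 1) + 6 * c"
      using i(2) j(3) by (intro add_mono mult_le_mono) auto
    also have "\<dots> \<le> c * (32 * t + 10)" using c(1) by (simp add: algebra_simps)
    finally show False using h(1) c(1) by (simp add: x_def)
  qed
  then have "measure_pmf.prob H ?E \<le> measure_pmf.prob H (L \<union> none (length u + 1))"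
    by (rule measure_pmf.finite_measure_mono) simp
  also have "\<dots> \<le> measure_pmf.prob H L + measure_pmf.prob H (none (length u + 1))"
    by (rule measure_Un_le) auto
  also have "\<dots> \<le> (3 / 4) ^ t + (3 / 4) ^ t"
    using none by (intro add_mono) (auto simp: L_def)
  finally show ?thesis by simp
qed

text \<open>The constants \<open>32\<close> and \<open>10\<close> are those of \<open>prob_phi_deletion_gt_le\<close>, and \<open>7 / 6\<close> is chosen
  such that \<open>7 / 6 * (3 / 4) < 1\<close>.\<close>

definition exp_tail :: "'h pmf \<Rightarrow> ('h \<Rightarrow> nat) \<Rightarrow> bool" where
  "exp_tail H D \<longleftrightarrow> (\<exists>Z B. (\<forall>h. D h \<le> 32 * Z h + 10 \<and> Z h \<le> (B :: nat)) \<and>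
     measure_pmf.expectation H (\<lambda>h. (7 / 6) ^ Z h) \<le> (4 :: real))"

text \<open>\<open>(7 / 6) ^ Z\<close> telescopes into steps \<open>(1 / 6) * (7 / 6) ^ t\<close>
  over \<open>t < Z\<close>. The tail bounds the expectation by \<open>1 + (1 / 3) * 8\<close>,
  where \<open>8\<close> is the sum of the powers of \<open>7 / 8 = 7 / 6 * (3 / 4)\<close>. The
  bound \<open>B\<close> keeps the sum finite.\<close>

lemma expectation_power_le:
  fixes Z :: "'h \<Rightarrow> nat"
  assumes bound: "\<And>h. Z h \<le> B"
    and tail: "\<And>t. measure_pmf.prob H {h. t < Z h} \<le> 2 * (3 / 4) ^ t"
  shows "measure_pmf.expectation H (\<lambda>h. (7 / 6) ^ Z h) \<le> (4 :: real)"
proof -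
  have "(7 / 6) ^ Z h = 1 + (\<Sum>t<B. (1 / 6) * (7 / 6) ^ t * indicator {h. t < Z h} h :: real)" for h
  proof -
    have "(\<Sum>t<B. (1 / 6) * (7 / 6) ^ t * indicator {h. t < Z h} h :: real)
        = (\<Sum>t\<in>{..<Z h}. (1 / 6) * (7 / 6) ^ t)"
      using bound[of h] by (intro sum.mono_neutral_cong_right) (auto simp: indicator_def)
    also have "\<dots> = (7 / 6) ^ Z h - 1"
      unfolding sum_distrib_left[symmetric] by (subst geometric_sum) auto
    finally show ?thesis by simp
  qed
  then have "measure_pmf.expectation H (\<lambda>h. (7 / 6) ^ Z h) = measure_pmf.expectation H
      (\<lambda>h. 1 + (\<Sum>t<B. (1 / 6) * (7 / 6) ^ t * indicator {h. t < Z h} h :: real))"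
    by presburger
  also have "\<dots> = 1 + (\<Sum>t<B. (1 / 6) * (7 / 6) ^ t * measure_pmf.prob H {h. t < Z h})"
  proof -
    have "integrable (measure_pmf H) (\<lambda>h. (1 / 6) * (7 / 6) ^ t * indicator {h. t < Z h} h :: real)" for t
      by (intro integrable_mult_right integrable_real_indicator)
        (auto simp: measure_pmf.emeasure_eq_measure)
    then show ?thesis
      by (subst Bochner_Integration.integral_add)
        (auto simp: Bochner_Integration.integral_sum simp del: mult_divide_mult_cancel_left)
  qed
  also have "\<dots> \<le> 1 + (\<Sum>t<B. (1 / 6) * (7 / 6) ^ t * (2 * (3 / 4) ^ t))"
    by (intro add_left_mono sum_mono mult_left_mono tail) simp
  also have "(\<Sum>t<B. (1 / 6) * (7 / 6) ^ t * (2 * (3 / 4) ^ t)) = (1 / 3) * (\<Sum>t<B. (7 / 8 :: real) ^ t)"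
    unfolding sum_distrib_left by (intro sum.cong refl) (simp add: power_mult_distrib[symmetric])
  also have "(\<Sum>t<B. (7 / 8 :: real) ^ t) \<le> 8"
    by (subst geometric_sum) (auto simp: divide_simps)
  finally show ?thesis by simp
qed

lemma exp_tail_phi_deletion:
  assumes fam: "k_wise_indep_family n A l H" and x: "u @ a # v \<in> perms_le n A"
    and c: "c > 0" "4 * c \<le> n \<longrightarrow> 8 * c \<le> 2 ^ l"
  shows "exp_tail H (\<lambda>h. edit_distance (phi c h (u @ a # v)) (phi c h (u @ v)))"
proof -
  define D where "D h = edit_distance (phi c h (u @ a # v)) (phi c h (u @ v))" for h
  \<comment> \<open>This is \<open>(D - 10) / 32\<close> rounded up, with \<open>D < 10\<close>
    treated as \<open>10\<close>: then \<open>t < Z\<close> is exactly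
    \<open>32 * t + 10 < D\<close>.\<close>
  define Z where "Z h = (D h - 10 + 31) div 32" for h
  have len: "length (phi c h w) \<le> 2 * length w + 3 * c" for h and w :: "'a list"
  proof -
    have "length (phi c h w) \<le> c * length (phi c h w)" using c(1) by simp
    then show ?thesis using length_phi_le[OF c(1), of h w] by linarith
  qed
  have D_le: "D h \<le> 2 * length (u @ a # v) + 3 * c + (2 * length (u @ v) + 3 * c)" for h
    using edit_distance_le_lengths[of "phi c h (u @ a # v)" "phi c h (u @ v)"]
      len[of h "u @ a # v"] len[of h "u @ v"] unfolding D_def by linarith
  define B where "B = 2 * length (u @ a # v) + 3 * c + (2 * length (u @ v) + 3 * c) + 31"
  have Z_le: "Z h \<le> B" for h
  proof -
    have "Z h \<le> D h + 31" unfolding Z_def by linarith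
    then show ?thesis using D_le[of h] unfolding B_def by linarith
  qed
  have tail: "measure_pmf.prob H {h. t < Z h} \<le> 2 * (3 / 4) ^ t" for t
  proof -
    have "{h. t < Z h} = {h. 32 * t + 10 < D h}" unfolding Z_def by (intro Collect_cong) linarith
    then show ?thesis using prob_phi_deletion_gt_le[OF fam x c, of t] by (simp only: D_def)
  qed
  have "D h \<le> 32 * Z h + 10" for h unfolding Z_def by linarith
  then show ?thesis
    unfolding exp_tail_def D_def[symmetric] using Z_le expectation_power_le[OF Z_le tail] by blast
qed

section \<open>From one deletion to two arbitrary permutations\<close>

lemma subseq_neq_deletion:
  assumes "subseq z x" "z \<noteq> x"
  shows "\<exists>u a v. x = u @ a # v \<and> subseq z (u @ v)"
  using assms
proof (induction)
  case (list_emb_Nil ys)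
  then show ?case by (cases ys) (auto intro!: exI[of _ "[]"])
next
  case (list_emb_Cons xs ys y)
  then show ?case by (intro exI[of _ "[]"]) auto
next
  case (list_emb_Cons2 x y xs ys)
  then obtain u a v where "ys = u @ a # v" "subseq xs (u @ v)" by auto
  then show ?case using list_emb_Cons2.hyps by (intro exI[of _ "y # u"]) auto
qed

text \<open>One summand per deleted letter. They are kept apart in a list because
  \<open>exp_tail\<close> is not inherited by sums in general.\<close>

lemma phi_subseq_chain:
  assumes fam: "k_wise_indep_family n A l H" and c: "c > 0" "4 * c \<le> n \<longrightarrow> 8 * c \<le> 2 ^ l"
    and "x \<in> perms_le n A" "subseq z x"
  shows "\<exists>Ds. length Ds = length x - length z \<and> (\<forall>D\<in>set Ds. exp_tail H D) \<and>
    (\<forall>h. edit_distance (phi c h x) (phi c h z) \<le> (\<Sum>D\<leftarrow>Ds. D h))"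
  using assms(4,5)
proof (induction "length x" arbitrary: x rule: less_induct)
  case less
  show ?case
  proof (cases "z = x")
    case False
    then obtain u a v where x: "x = u @ a # v" "subseq z (u @ v)"
      using subseq_neq_deletion less.prems by blast
    have "u @ v \<in> perms_le n A" using less.prems x by (auto simp: perms_le_def)
    with less.hyps[of "u @ v"] x obtain Ds where Ds: "length Ds = length (u @ v) - length z"
      "\<forall>D\<in>set Ds. exp_tail H D"
      "\<forall>h. edit_distance (phi c h (u @ v)) (phi c h z) \<le> (\<Sum>D\<leftarrow>Ds. D h)" by auto
    have "length z \<le> length (u @ v)" using x(2) list_emb_length by blast
    moreover have "edit_distance (phi c h x) (phi c h z)
        \<le> edit_distance (phi c h (u @ a # v)) (phi c h (u @ v)) + (\<Sum>D\<leftarrow>Ds. D h)" for h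
      using edit_distance_triangle[of "phi c h x" "phi c h z" "phi c h (u @ v)"] Ds(3) x(1)
      by (meson add_le_cancel_left le_trans)
    ultimately show ?thesis
      using Ds exp_tail_phi_deletion[OF fam _ c, of u a v] less.prems x(1)
      by (intro exI[of _ "(\<lambda>h. edit_distance (phi c h (u @ a # v)) (phi c h (u @ v))) # Ds"]) auto
  qed (auto intro!: exI[of _ "[]"])
qed

text \<open>Both words are reduced to a common subsequence, by at most
  \<open>edit_distance x y\<close> deletions each; the insertions leading to \<open>y\<close> are
  deletions from \<open>y\<close> read backwards.\<close>

lemma phi_distance_le_sum:
  assumes fam: "k_wise_indep_family n A l H" and c: "c > 0" "4 * c \<le> n \<longrightarrow> 8 * c \<le> 2 ^ l"
    and x: "x \<in> perms_le n A" and y: "y \<in> perms_le n A"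
  obtains Ds where "length Ds \<le> 2 * edit_distance x y" "\<forall>D\<in>set Ds. exp_tail H D"
    "\<And>h. edit_distance (phi c h x) (phi c h y) \<le> (\<Sum>D\<leftarrow>Ds. D h)"
proof -
  obtain z where z: "subseq z x" "subseq z y" "length x \<le> length z + edit_distance x y"
    "length y \<le> length z + edit_distance x y"
    using relpowp_edit_step_common_subseq[OF edit_distance_path[of x y]] by blast
  obtain Ds where Ds: "length Ds = length x - length z" "\<forall>D\<in>set Ds. exp_tail H D"
    "\<forall>h. edit_distance (phi c h x) (phi c h z) \<le> (\<Sum>D\<leftarrow>Ds. D h)"
    using phi_subseq_chain[OF fam c x z(1)] by blast
  obtain Es where Es: "length Es = length y - length z" "\<forall>D\<in>set Es. exp_tail H D"
    "\<forall>h. edit_distance (phi c h y) (phi c h z) \<le> (\<Sum>D\<leftarrow>Es. D h)"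
    using phi_subseq_chain[OF fam c y z(2)] by blast
  show thesis
  proof (rule that[of "Ds @ Es"])
    show "edit_distance (phi c h x) (phi c h y) \<le> (\<Sum>D\<leftarrow>Ds @ Es. D h)" for h
    proof -
      have "edit_distance (phi c h x) (phi c h y)
          \<le> edit_distance (phi c h x) (phi c h z) + edit_distance (phi c h y) (phi c h z)"
        using edit_distance_triangle edit_distance_commute by metis
      also have "\<dots> \<le> (\<Sum>D\<leftarrow>Ds. D h) + (\<Sum>D\<leftarrow>Es. D h)"
        using Ds(3) Es(3) by (intro add_mono) auto
      finally show ?thesis by simp
    qed
  qed (use Ds Es z in auto)
qed

lemma exp_tail_sum:
  assumes Ds: "\<forall>D\<in>set Ds. exp_tail H D" and Y: "\<And>h. Y h \<le> (\<Sum>D\<leftarrow>Ds. D h)"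
    and d: "length Ds \<le> 2 * d"
  shows expectation_exp_tail_sum: "measure_pmf.expectation H (\<lambda>h. real (Y h)) \<le> 1556 * real d"
      and integrable_exp_tail_sum: "integrable (measure_pmf H) (\<lambda>h. real (Y h))"
      and prob_exp_tail_sum: "measure_pmf.prob H {h. Y h > m * d}
        \<le> (1 / 2) powr (ln (7 / 6) * (real m - 20) / (64 * ln 2) - 2)"
proof -
  define k where "k = length Ds"
  define dom where "dom i p \<longleftrightarrow> (\<forall>h. (Ds ! i) h \<le> 32 * fst p h + 10 \<and> fst p h \<le> (snd p :: nat)) \<and>
      measure_pmf.expectation H (\<lambda>h. (7 / 6) ^ fst p h) \<le> (4 :: real)" for i p
  have "\<forall>i\<in>{..<k}. \<exists>p. dom i p"
  proof
    fix i assume "i \<in> {..<k}"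
    then have "exp_tail H (Ds ! i)" using Ds by (simp add: k_def)
    then obtain Z B where "dom i (Z, B)" unfolding exp_tail_def dom_def by auto
    then show "\<exists>p. dom i p" by blast
  qed
  from bchoice[OF this] obtain f where f: "\<forall>i\<in>{..<k}. dom i (f i)" ..
  define Z where "Z i = fst (f i)" for i
  define B where "B i = snd (f i)" for i
  have Z: "(Ds ! i) h \<le> 32 * Z i h + 10" "Z i h \<le> B i"
    "measure_pmf.expectation H (\<lambda>h. (7 / 6) ^ Z i h) \<le> (4 :: real)" if "i < k" for i h
    using f that by (auto simp: dom_def Z_def B_def)
  have Y_le: "Y h \<le> (\<Sum>i<k. 32 * Z i h + 10)" for h
  proof -
    have "(\<Sum>D\<leftarrow>Ds. D h) = (\<Sum>i<k. (Ds ! i) h)"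
      by (simp add: sum_list_sum_nth k_def atLeast0LessThan)
    also have "\<dots> \<le> (\<Sum>i<k. 32 * Z i h + 10)" using Z(1) by (intro sum_mono) auto
    finally show ?thesis using Y order_trans by blast
  qed
  have int: "integrable (measure_pmf H) (\<lambda>h. F (Z i h) :: real)" if "i < k" for i F
  proof (rule measure_pmf.integrable_const_bound)
    show "AE h in measure_pmf H. norm (F (Z i h)) \<le> Max ((norm \<circ> F) ` {..B i})"
      using Z(2)[OF that] by (intro AE_I2 Max_ge) auto
  qed simp
  have int_Z: "integrable (measure_pmf H) (\<lambda>h. \<Sum>i<k. 32 * real (Z i h) + 10)"
    using int[of _ real] by (intro Bochner_Integration.integrable_sum
      Bochner_Integration.integrable_add integrable_mult_right) auto
  have Y_real: "real (Y h) \<le> (\<Sum>i<k. 32 * real (Z i h) + 10)" for h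
    using Y_le[of h] of_nat_mono[OF Y_le[of h], where 'a = real] by simp
  show int_Y: "integrable (measure_pmf H) (\<lambda>h. real (Y h))"
    by (rule Bochner_Integration.integrable_bound[OF int_Z])
      (use Y_real in \<open>auto intro!: AE_I2 order_trans[OF Y_real] sum_nonneg\<close>)
  have exp_Z: "measure_pmf.expectation H (\<lambda>h. real (Z i h)) \<le> 24" if "i < k" for i
  proof -
    \<comment> \<open>Bernoulli gives \<open>(7 / 6) ^ Z >= 1 + Z / 6\<close>; with the moment bound
      \<open>4\<close> the mean is at most \<open>6 * 4 = 24\<close>.\<close>
    have "real (Z i h) \<le> 6 * (7 / 6) ^ Z i h" for h
      using Bernoulli_inequality[of "1 / 6 :: real" "Z i h"] by simp
    then have "measure_pmf.expectation H (\<lambda>h. real (Z i h))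
        \<le> measure_pmf.expectation H (\<lambda>h. 6 * (7 / 6) ^ Z i h)"
      using int[OF that, of real] int[OF that, of "\<lambda>z. 6 * (7 / 6) ^ z"] by (intro integral_mono) auto
    also have "\<dots> \<le> 24" using Z(3)[OF that] by simp
    finally show ?thesis .
  qed
  have "measure_pmf.expectation H (\<lambda>h. real (Y h))
      \<le> measure_pmf.expectation H (\<lambda>h. \<Sum>i<k. 32 * real (Z i h) + 10)"
    using int_Y int_Z Y_real by (intro integral_mono) auto
  also have "\<dots> = (\<Sum>i<k. 32 * measure_pmf.expectation H (\<lambda>h. real (Z i h)) + 10)"
    using int[of _ real] by (subst Bochner_Integration.integral_sum) auto
  also have "\<dots> \<le> (\<Sum>i<k. 32 * 24 + 10)"
    using exp_Z by (intro sum_mono add_right_mono mult_left_mono) auto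
  also have "\<dots> \<le> 1556 * real d" using d by (simp add: k_def)
  finally show "measure_pmf.expectation H (\<lambda>h. real (Y h)) \<le> 1556 * real d" .
  show "measure_pmf.prob H {h. Y h > m * d}
        \<le> (1 / 2) powr (ln (7 / 6) * (real m - 20) / (64 * ln 2) - 2)" (is "_ \<le> ?rhs")
  proof (cases "k = 0")
    case True
    then have "Y h = 0" for h using Y_le[of h] by simp
    then show ?thesis by simp
  next
    case False
    define r :: real where "r = ln (7 / 6)"
    define G where "G h = (\<Sum>i<k. (1 / real k) * (7 / 6) ^ Z i h :: real)" for h
    have int_G: "integrable (measure_pmf H) G" unfolding G_def
      using int[of _ "\<lambda>z. (7 / 6) ^ z"] by (intro Bochner_Integration.integrable_sum integrable_mult_right) auto
    have "measure_pmf.expectation H G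
        = (\<Sum>i<k. (1 / real k) * measure_pmf.expectation H (\<lambda>h. (7 / 6) ^ Z i h))"
      unfolding G_def using int[of _ "\<lambda>z. (7 / 6) ^ z"]
      by (subst Bochner_Integration.integral_sum) auto
    also have "\<dots> \<le> (\<Sum>i<k. (1 / real k) * 4)"
      using Z(3) by (intro sum_mono mult_left_mono) auto
    also have "\<dots> = 4" using False by simp
    finally have exp_G: "measure_pmf.expectation H G \<le> 4" .
    \<comment> \<open>The summands are dependent, but by convexity the exponential moment of their average is at
      most the average of their exponential moments.\<close>
    have jensen: "exp (\<Sum>i<k. (1 / real k) * (r * real (Z i h))) \<le> G h" for h
    proof -
      have "exp (\<Sum>i<k. (1 / real k) *\<^sub>R (r * real (Z i h)))
          \<le> (\<Sum>i<k. (1 / real k) * exp (r * real (Z i h)))"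
        using False by (intro convex_on_sum[where C = UNIV]) (auto intro: exp_convex)
      also have "\<dots> = G h"
        by (simp add: G_def r_def exp_of_nat2_mult)
      finally show ?thesis by simp
    qed
    \<comment> \<open>As \<open>k <= 2 * d\<close>, the event \<open>Y h > m * d\<close> gives
      \<open>m * k <= 64 * S + 20 * k\<close> for the sum \<open>S\<close> of the
      \<open>Z i h\<close>, so their average is at least \<open>(m - 20) / 64\<close>. In the Markov
      bound \<open>4 / b\<close> the \<open>4\<close> becomes the \<open>- 2\<close> in the exponent
      of \<open>1 / 2\<close>.\<close>
    define b where "b = exp (r * (real m - 20) / 64)"
    have "{h. Y h > m * d} \<subseteq> {h. G h \<ge> b}"
    proof safe
      fix h assume h: "m * d < Y h"
      have "real m * real k \<le> 2 * (real m * real d)"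
      proof -
        have "m * k \<le> m * (2 * d)" using d by (simp add: k_def)
        then have "real (m * k) \<le> real (m * (2 * d))" by (rule of_nat_mono)
        then show ?thesis by simp
      qed
      also have "real m * real d \<le> (\<Sum>i<k. 32 * real (Z i h) + 10)"
        using h Y_real[of h] of_nat_mono[OF less_imp_le[OF h], where 'a = real] by simp
      finally have "real m * real k \<le> 64 * (\<Sum>i<k. real (Z i h)) + 20 * real k"
        by (simp add: sum.distrib sum_distrib_left[symmetric])
      then have "(real m - 20) / 64 \<le> (1 / real k) * (\<Sum>i<k. real (Z i h))"
        using False by (simp add: field_simps)
      moreover have "r \<ge> 0" by (simp add: r_def)
      ultimately have "r * ((real m - 20) / 64) \<le> r * ((1 / real k) * (\<Sum>i<k. real (Z i h)))"
        by (rule mult_left_mono)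
      also have "\<dots> = (\<Sum>i<k. (1 / real k) * (r * real (Z i h)))"
        by (simp add: sum_distrib_left mult_ac)
      finally have "b \<le> exp (\<Sum>i<k. (1 / real k) * (r * real (Z i h)))"
        unfolding b_def by simp
      then show "b \<le> G h" using jensen order_trans by blast
    qed
    then have "measure_pmf.prob H {h. Y h > m * d} \<le> measure_pmf.prob H {h. G h \<ge> b}"
      by (rule measure_pmf.finite_measure_mono) simp
    also have "\<dots> \<le> measure_pmf.expectation H G / b"
    proof -
      have "0 \<le> G h" for h unfolding G_def by (intro sum_nonneg) simp
      moreover have "0 < b" by (simp add: b_def)
      ultimately show ?thesis
        using integral_Markov_inequality_measure[OF int_G, of "{}" b] by simp
    qed
    also have "\<dots> \<le> 4 / b" using exp_G by (intro divide_right_mono) (auto simp: b_def)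
    also have "4 / b = ?rhs"
    proof -
      have "?rhs = exp (2 * ln 2 - r * (real m - 20) / 64)"
        by (simp add: powr_def r_def ln_div field_simps)
      also have "\<dots> = exp (2 * ln 2) / b" by (simp add: b_def exp_diff)
      also have "exp (2 * ln 2) = (4 :: real)" using exp_of_nat_mult[of 2 "ln 2 :: real"] by simp
      finally show ?thesis by simp
    qed
    finally show ?thesis .
  qed
qed

section \<open>The word RAM program\<close>

text \<open>A total-correctness triple with a time budget. Only an upper bound is tracked and handed
  down by subtraction, so branches of different cost share one budget.\<close>

definition stops_within ::
  "nat \<Rightarrow> (nat \<Rightarrow> nat) \<Rightarrow> com \<Rightarrow> state \<Rightarrow> nat \<Rightarrow> (state \<Rightarrow> bool) \<Rightarrow> bool" where
  "stops_within w h P s T Q \<longleftrightarrow> (\<exists>t s'. run w h P s t s' \<and> t \<le> T \<and> Q s')"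

lemma stops_within_mono:
  assumes "stops_within w h P s T Q" "T \<le> T'" "\<And>s'. Q s' \<Longrightarrow> Q' s'"
  shows "stops_within w h P s T' Q'"
proof -
  obtain t s' where "run w h P s t s'" "t \<le> T" "Q s'" using assms(1) by (auto simp: stops_within_def)
  then have "run w h P s t s' \<and> t \<le> T' \<and> Q' s'" using assms(2,3) by simp
  then show ?thesis unfolding stops_within_def by blast
qed

lemma stops_within_Seq:
  assumes "stops_within w h P s T Q" "T \<le> U"
    and "\<And>s'. Q s' \<Longrightarrow> stops_within w h P' s' (U - T) Q'"
  shows "stops_within w h (Seq P P') s U Q'"
proof -
  obtain t s' where s': "run w h P s t s'" "t \<le> T" "Q s'"
    using assms(1) by (auto simp: stops_within_def)
  then obtain t' s'' where "run w h P' s' t' s''" "t' \<le> U - T" "Q' s''"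
    using assms(3)[OF s'(3)] by (auto simp: stops_within_def)
  then have "run w h (Seq P P') s (t + t') s'' \<and> t + t' \<le> U \<and> Q' s''"
    using s' assms(2) by (auto intro: run.seq)
  then show ?thesis unfolding stops_within_def by blast
qed

lemma stops_within_Seq_assoc:
  assumes "stops_within w h (Seq P1 (Seq P2 P3)) s T Q"
  shows "stops_within w h (Seq (Seq P1 P2) P3) s T Q"
proof -
  obtain t s' where "run w h (Seq P1 (Seq P2 P3)) s t s'" and t: "t \<le> T" "Q s'"
    using assms by (auto simp: stops_within_def)
  then obtain t1 t2 t3 s1 s2 where "run w h P1 s t1 s1" "run w h P2 s1 t2 s2" "run w h P3 s2 t3 s'"
    "t = t1 + (t2 + t3)"
    by (auto elim!: run.cases[of w h "Seq _ _"])
  then have "run w h (Seq (Seq P1 P2) P3) s t s'"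
    using run.seq[OF run.seq] by (metis add.assoc)
  then show ?thesis using t unfolding stops_within_def by blast
qed

lemma stops_within_IfLess:
  assumes "1 \<le> T" "fst s r < fst s r' \<Longrightarrow> stops_within w h P s (T - 1) Q"
    and "\<not> fst s r < fst s r' \<Longrightarrow> stops_within w h P' s (T - 1) Q"
  shows "stops_within w h (IfLess r r' P P') s T Q"
proof (cases "fst s r < fst s r'")
  case True
  then obtain t s' where "run w h P s t s'" "t \<le> T - 1" "Q s'"
    using assms(2) by (auto simp: stops_within_def)
  then have "run w h (IfLess r r' P P') s (1 + t) s' \<and> 1 + t \<le> T \<and> Q s'"
    using True assms(1) by (auto intro: run.if_true[simplified])
  then show ?thesis unfolding stops_within_def by blast
next
  case False
  then obtain t s' where "run w h P' s t s'" "t \<le> T - 1" "Q s'"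
    using assms(3) by (auto simp: stops_within_def)
  then have "run w h (IfLess r r' P P') s (1 + t) s' \<and> 1 + t \<le> T \<and> Q s'"
    using False assms(1) by (auto intro: run.if_false[simplified])
  then show ?thesis unfolding stops_within_def by blast
qed

text \<open>Moves the continuation into both branches, so that symbolic execution ends in
  straight-line paths.\<close>

lemma stops_within_IfLess_Seq:
  assumes "1 \<le> T" "fst s r < fst s r' \<Longrightarrow> stops_within w h (Seq P P'') s (T - 1) Q"
    and "\<not> fst s r < fst s r' \<Longrightarrow> stops_within w h (Seq P' P'') s (T - 1) Q"
  shows "stops_within w h (Seq (IfLess r r' P P') P'') s T Q"
proof -
  have lift: "stops_within w h (Seq (IfLess r r' P P') P'') s T Q"
    if B: "stops_within w h (Seq B P'') s (T - 1) Q"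
      and step: "\<And>t s'. run w h B s t s' \<Longrightarrow> run w h (IfLess r r' P P') s (1 + t) s'" for B
  proof -
    obtain t s' where "run w h (Seq B P'') s t s'" and t: "t \<le> T - 1" "Q s'"
      using B by (auto simp: stops_within_def)
    then obtain t1 t2 s1 where "run w h B s t1 s1" "run w h P'' s1 t2 s'" "t = t1 + t2"
      by (auto elim: run.cases[of w h "Seq _ _"])
    then have "run w h (Seq (IfLess r r' P P') P'') s (1 + t1 + t2) s' \<and> 1 + t1 + t2 \<le> T \<and> Q s'"
      using run.seq[OF step] t assms(1) by auto
    then show ?thesis unfolding stops_within_def by blast
  qed
  show ?thesis
    using lift[of P] lift[of P'] assms(2,3) run.if_true[of s r r'] run.if_false[of s r r'] by blast
qed

text \<open>\<open>V\<close> is measured in time: a round lowers it by its budget plus one for the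
  test, so the initial \<open>V\<close> pays for all rounds, and the extra \<open>1\<close> for the
  last test.\<close>

lemma stops_within_WhileLess:
  fixes V :: "state \<Rightarrow> nat"
  assumes step: "\<And>s. I s \<Longrightarrow> fst s r < fst s r' \<Longrightarrow>
      stops_within w h P s T (\<lambda>s'. I s' \<and> V s' + T + 1 \<le> V s)"
    and "I s"
  shows "stops_within w h (WhileLess r r' P) s (V s + 1) (\<lambda>s'. I s' \<and> \<not> fst s' r < fst s' r')"
  using assms(2)
proof (induction "V s" arbitrary: s rule: less_induct)
  case less
  show ?case
  proof (cases "fst s r < fst s r'")
    case True
    obtain t s' where s': "run w h P s t s'" "t \<le> T" "I s'" "V s' + T + 1 \<le> V s"
      using step[OF less.prems True] by (auto simp: stops_within_def)
    then obtain t' s'' where s'': "run w h (WhileLess r r' P) s' t' s''" "t' \<le> V s' + 1"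
      "I s''" "\<not> fst s'' r < fst s'' r'"
      using less.hyps[of s'] by (auto simp: stops_within_def)
    show ?thesis unfolding stops_within_def
      using run.while_true[of s r r', OF True s'(1) s''(1)] s' s'' by (intro exI conjI) auto
  next
    case False
    then show ?thesis unfolding stops_within_def
      using less.prems run.while_false[of s r r' w h P] by (intro exI conjI) auto
  qed
qed

fun straight :: "instr list \<Rightarrow> com" where
  "straight [] = Skip"
| "straight (i # is) = Seq (Do i) (straight is)"

lemma run_straight: "run w h (straight is) s (length is + 1) (fold (exec_instr w h) is s)"
proof (induction "is" arbitrary: s)
  case Nil
  then show ?case using run.skip by simp
next
  case (Cons i "is")
  show ?case using run.seq[OF run.instr Cons.IH, of i s] by (simp add: add.commute)
qed

lemma stops_within_straight:
  "length is + 1 \<le> T \<Longrightarrow> Q (fold (exec_instr w h) is s) \<Longrightarrow> stops_within w h (straight is) s T Q"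
  unfolding stops_within_def using run_straight by blast

lemma stops_within_straight_Seq:
  assumes "length is + 1 \<le> T"
    and "stops_within w h P (fold (exec_instr w h) is s) (T - (length is + 1)) Q"
  shows "stops_within w h (Seq (straight is) P) s T Q"
proof (rule stops_within_Seq[OF _ assms(1)])
  show "stops_within w h (straight is) s (length is + 1) ((=) (fold (exec_instr w h) is s))"
    by (rule stops_within_straight) simp_all
  show "stops_within w h P s' (T - (length is + 1)) Q" if "fold (exec_instr w h) is s = s'" for s'
    using assms(2) unfolding that .
qed

lemmas stops_within_intros = stops_within_straight_Seq stops_within_straight
  stops_within_IfLess_Seq stops_within_IfLess stops_within_Seq_assoc

text \<open>Register \<open>0\<close> holds the length \<open>N\<close> of the input, register \<open>1\<close> holds \<open>c\<close>, register \<open>2\<close> holds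
  \<open>1\<close>, and register \<open>15\<close> is never written and holds \<open>0\<close>.  The cell \<open>N + i\<close> is set to \<open>1\<close> if
  position \<open>i\<close> is a marker; the output is written from the address \<open>2 * N\<close> on.

  Two markers are more than \<open>c\<close> apart, so among the positions \<open>s, \<dots>, s + c - 1\<close> only one of minimal
  hash can be a marker.  Inspecting its window takes time \<open>O(c)\<close>, which is \<open>O(1)\<close> per position
  independently of \<open>c\<close>.\<close>

abbreviation argmin_body :: com where
  "argmin_body \<equiv> Seq (straight [Load 8 5, Hash 8 8])
     (Seq (IfLess 8 7 (straight [Add 6 5 15, Add 7 8 15]) (straight [])) (straight [Add 5 5 2]))"

definition argmin_loop :: com where
  "argmin_loop = WhileLess 5 4 argmin_body"

text \<open>Register \<open>10\<close> counts the window positions whose hash does not exceed that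
  of the candidate, held in register \<open>7\<close>. The candidate counts itself, hence the
  comparison with \<open>2\<close> in \<open>set_mark\<close>.\<close>

abbreviation count_body :: com where
  "count_body \<equiv> Seq (straight [Load 8 5, Hash 8 8])
     (Seq (IfLess 7 8 (straight []) (straight [Add 10 10 2])) (straight [Add 5 5 2]))"

definition count_loop :: com where
  "count_loop = WhileLess 5 9 count_body"

abbreviation set_mark :: com where
  "set_mark \<equiv> IfLess 10 11 (straight [Add 8 0 6, Store 8 2]) (straight [])"

abbreviation check_argmin :: com where
  "check_argmin \<equiv> Seq (straight [Add 9 6 1])
     (Seq (IfLess 9 0
        (Seq (straight [Sub 5 6 1, Add 9 9 2, Const 10 0]) (Seq count_loop set_mark))
        (straight []))
     (straight [Add 3 4 15, Add 4 3 1]))"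

abbreviation mark_body :: com where
  "mark_body \<equiv> Seq (straight [Add 6 3 15, Load 8 6, Hash 7 8, Add 5 3 2])
     (Seq argmin_loop check_argmin)"

text \<open>The search starts at position \<open>c\<close> and ends once \<open>s + c\<close>, held
  in register \<open>4\<close>, reaches \<open>N\<close>: the positions left out have no full
  window.\<close>

definition mark_prog :: com where
  "mark_prog = Seq (straight [Const 2 1, Const 11 2, Add 3 1 15, Add 4 3 1])
     (WhileLess 4 0 mark_body)"

text \<open>Registers \<open>12\<close>, \<open>13\<close> and \<open>14\<close> hold the next free
  address, the address of the length cell of the open block, and its length. Length \<open>c\<close>
  forces a new block, so a marker sets register \<open>14\<close> to \<open>c\<close>, as does the
  initialisation.\<close>

abbreviation write_body :: com where
  "write_body \<equiv> Seq (straight [Add 8 0 5, Load 8 8])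
     (Seq (IfLess 15 8 (straight [Add 14 1 15]) (straight []))
     (Seq (IfLess 14 1 (straight [])
        (straight [Add 13 12 15, Add 12 12 2, Const 14 0, Add 10 10 2]))
     (straight [Load 8 5, Store 12 8, Add 12 12 2, Add 14 14 2, Store 13 14, Add 5 5 2])))"

definition write_prog :: com where
  "write_prog =
     Seq (straight [Add 11 0 0, Add 12 11 2, Const 10 0, Add 14 1 15, Const 5 0])
     (Seq (WhileLess 5 0 write_body) (straight [Store 11 10, Add 0 11 15]))"

definition phi_prog :: com where
  "phi_prog = Seq mark_prog write_prog"

text \<open>The output starts at \<open>2 * N\<close> and takes at most \<open>2 * N + 1\<close>
  cells, so \<open>words\<close> leaves room for all addresses and window ends without wrap-around;
  \<open>hash_lt\<close> keeps hash values intact under truncation to words.\<close>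

locale ram_input =
  fixes w :: nat and h :: "nat \<Rightarrow> nat" and c :: nat and x :: "nat list"
  assumes c_pos: "c > 0"
    and words: "8 * (length x + c) \<le> 2 ^ w"
    and hash_lt: "\<And>a. a \<in> set x \<Longrightarrow> h a < 2 ^ w"
begin

abbreviation N :: nat where "N \<equiv> length x"

lemma mod_word [simp]: "v < 8 * (N + c) \<Longrightarrow> v mod 2 ^ w = v"
  using words by simp

lemma word_size_pos [simp]: "w > 0"
  using words c_pos by (cases w) auto

lemma mod_word_hash [simp]: "j < N \<Longrightarrow> h (x ! j) mod 2 ^ w = h (x ! j)"
  using hash_lt by simp

lemma mod_word_diff [simp]:
  assumes "k \<le> v" "v < 8 * (N + c)"
  shows "(v + 2 ^ w - k) mod 2 ^ w = v - k"
proof -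
  have "v + 2 ^ w - k = (v - k) + 2 ^ w" using assms(1) by simp
  moreover have "v - k < 2 ^ w" using assms words by linarith
  ultimately show ?thesis by (simp only: mod_add_self2 mod_less)
qed

definition mark_mem :: "nat \<Rightarrow> nat \<Rightarrow> nat" where
  "mark_mem s a = (if a < N then x ! a else if a < N + s \<and> marker c h x (a - N) then 1 else 0)"

lemma mark_mem_input [simp]: "j < N \<Longrightarrow> mark_mem s j = x ! j"
  by (simp add: mark_mem_def)

definition frame :: "nat \<Rightarrow> state \<Rightarrow> bool" where
  "frame s st \<longleftrightarrow> fst st 0 = N \<and> fst st 1 = c \<and> fst st 2 = 1 \<and> fst st 11 = 2 \<and> fst st 3 = s \<and>
     fst st 4 = s + c \<and> fst st 15 = 0 \<and> snd st = mark_mem s"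

definition argmin_inv :: "nat \<Rightarrow> state \<Rightarrow> bool" where
  "argmin_inv s st \<longleftrightarrow> frame s st \<and> fst st 5 \<le> s + c \<and> s \<le> fst st 6 \<and> fst st 6 < fst st 5 \<and>
     fst st 7 = h (x ! fst st 6) \<and> (\<forall>j\<in>{s..<fst st 5}. fst st 7 \<le> h (x ! j))"

lemma argmin_loop_correct:
  assumes "s + c < N" "argmin_inv s st"
  shows "stops_within w h argmin_loop st (10 * (s + c - fst st 5) + 1)
    (\<lambda>st'. argmin_inv s st' \<and> \<not> fst st' 5 < fst st' 4)"
  unfolding argmin_loop_def
\<comment> \<open>The \<open>9\<close> consists of \<open>3\<close> for loading the hash,
  \<open>4\<close> for the conditional and \<open>2\<close> for the increment; the loop test makes
  it \<open>10\<close>.\<close>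
proof (rule stops_within_WhileLess[where V = "\<lambda>st. 10 * (s + c - fst st 5)" and T = 9])
  fix st assume st: "argmin_inv s st" "fst st 5 < fst st 4"
  obtain R M where RM [simp]: "st = (R, M)" by (cases st)
  have R: "R 0 = N" "R 1 = c" "R (Suc 0) = c" "R 2 = 1" "R 11 = 2" "R 3 = s" "R 4 = s + c" "R 15 = 0" "M = mark_mem s"
    "R 5 < s + c" "s \<le> R 6" "R 6 < R 5" "R 7 = h (x ! R 6)" "\<forall>j\<in>{s..<R 5}. R 7 \<le> h (x ! j)"
    using st by (auto simp: argmin_inv_def frame_def)
  have lt: "R 5 < N" "R 6 < N" using R assms(1) by auto
  have upto: "{s..<Suc (R 5)} = insert (R 5) {s..<R 5}" using R by auto
  show "stops_within w h argmin_body
     st 9 (\<lambda>st'. argmin_inv s st' \<and> 10 * (s + c - fst st' 5) + 9 + 1 \<le> 10 * (s + c - fst st 5))"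
    apply (insert R lt)
    apply (intro stops_within_intros)
    apply (simp_all add: argmin_inv_def frame_def upto)
    apply (auto simp: less_Suc_eq)
    done
qed (rule assms)

definition ties :: "nat \<Rightarrow> nat \<Rightarrow> nat set" where
  "ties p k = {j \<in> {p - c..<k}. \<not> h (x ! p) < h (x ! j)}"

lemma ties_Suc: "p - c \<le> k \<Longrightarrow> ties p (Suc k) = (if h (x ! p) < h (x ! k) then ties p k else insert k (ties p k))"
  by (auto simp: ties_def atLeastLessThanSuc)

lemma finite_ties [simp]: "finite (ties p k)" and not_in_ties [simp]: "k \<notin> ties p k"
  by (auto simp: ties_def)

lemma card_ties_le: "card (ties p k) \<le> k - (p - c)"
proof -
  have "card (ties p k) \<le> card {p - c..<k}" by (rule card_mono) (auto simp: ties_def)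
  then show ?thesis by simp
qed

text \<open>\<open>p\<close> always ties with itself, so being the unique minimum means that the
  count is one.\<close>

lemma marker_iff_card_ties:
  assumes "c \<le> p" "p + c < N"
  shows "marker c h x p \<longleftrightarrow> card (ties p (Suc (p + c))) < 2"
proof
  assume "marker c h x p"
  then have "ties p (Suc (p + c)) \<subseteq> {p}" by (auto simp: marker_def ties_def less_Suc_eq_le)
  then have "card (ties p (Suc (p + c))) \<le> card {p}" by (rule card_mono[rotated]) simp
  then show "card (ties p (Suc (p + c))) < 2" by simp
next
  assume card: "card (ties p (Suc (p + c))) < 2"
  show "marker c h x p" unfolding marker_def
  proof (intro conjI ballI assms, rule ccontr)
    fix j assume "j \<in> {p - c..p + c} - {p}" "\<not> h (x ! p) < h (x ! j)"
    then have "{p, j} \<subseteq> ties p (Suc (p + c))" "p \<noteq> j" by (auto simp: ties_def)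
    then have "card {p, j} \<le> card (ties p (Suc (p + c)))" by (intro card_mono) auto
    then show False using card \<open>p \<noteq> j\<close> by simp
  qed
qed

definition count_inv :: "nat \<Rightarrow> nat \<Rightarrow> state \<Rightarrow> bool" where
  "count_inv s p st \<longleftrightarrow> frame s st \<and> fst st 6 = p \<and> fst st 7 = h (x ! p) \<and> fst st 9 = Suc (p + c) \<and>
     p - c \<le> fst st 5 \<and> fst st 5 \<le> Suc (p + c) \<and> fst st 10 = card (ties p (fst st 5))"

lemma count_loop_correct:
  assumes "c \<le> p" "p + c < N" "count_inv s p st"
  shows "stops_within w h count_loop st (10 * (Suc (p + c) - fst st 5) + 1)
    (\<lambda>st'. count_inv s p st' \<and> \<not> fst st' 5 < fst st' 9)"
  unfolding count_loop_def
proof (rule stops_within_WhileLess[where V = "\<lambda>st. 10 * (Suc (p + c) - fst st 5)" and T = 9])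
  fix st assume st: "count_inv s p st" "fst st 5 < fst st 9"
  obtain R M where RM [simp]: "st = (R, M)" by (cases st)
  have R: "R 0 = N" "R 1 = c" "R (Suc 0) = c" "R 2 = 1" "R 11 = 2" "R 3 = s" "R 4 = s + c" "R 15 = 0"
    "M = mark_mem s" "R 6 = p" "R 7 = h (x ! p)" "R 9 = Suc (p + c)" "p - c \<le> R 5" "R 5 \<le> p + c"
    "R 10 = card (ties p (R 5))"
    using st by (auto simp: count_inv_def frame_def)
  have lt: "R 5 < N" "p < N" "card (ties p (R 5)) \<le> 2 * c"
    using R assms(1,2) card_ties_le[of p "R 5"] by auto
  show "stops_within w h count_body
     st 9 (\<lambda>st'. count_inv s p st' \<and> 10 * (Suc (p + c) - fst st' 5) + 9 + 1 \<le> 10 * (Suc (p + c) - fst st 5))"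
    apply (insert R lt)
    apply (intro stops_within_intros)
    apply (simp_all add: count_inv_def frame_def ties_Suc)
    done
qed (rule assms)

text \<open>A marker of this stretch other than \<open>p\<close> has \<open>p\<close> within
  distance \<open>c\<close>, hence a smaller hash than \<open>p\<close>, against minimality. So any
  choice of \<open>p\<close> among equal minima is correct.\<close>

lemma mark_mem_step:
  assumes "c \<le> s" "s + c < N" "s \<le> p" "p < s + c" "\<forall>j\<in>{s..<s + c}. h (x ! p) \<le> h (x ! j)"
  shows "mark_mem (s + c) = (if marker c h x p then (mark_mem s)(N + p := 1) else mark_mem s)"
proof -
  have unique: "i = p" if "marker c h x i" "s \<le> i" "i < s + c" for i
  proof (rule ccontr)
    assume "i \<noteq> p"
    then have "p \<in> {i - c..i + c} - {i}" using assms that by auto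
    then have "h (x ! i) < h (x ! p)" using that(1) unfolding marker_def by blast
    then show False using assms(5) that by (auto simp: not_le[symmetric])
  qed
  have set: "i < s + c \<and> marker c h x i \<longleftrightarrow> i < s \<and> marker c h x i \<or> i = p \<and> marker c h x p" for i
    using unique[of i] assms(4) by (cases "i < s") auto
  show ?thesis
  proof (rule ext)
    fix a
    show "mark_mem (s + c) a = (if marker c h x p then (mark_mem s)(N + p := 1) else mark_mem s) a"
    proof (cases "a < N")
      case False
      then obtain i where a: "a = N + i" using le_Suc_ex not_less by blast
      show ?thesis using set[of i] by (simp add: mark_mem_def a)
    qed (simp add: mark_mem_def)
  qed
qed

lemma marker_bounds: "marker c h x i \<Longrightarrow> c \<le> i \<and> i + c < N"
  by (simp add: marker_def)

lemma mark_mem_final: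
  assumes "N \<le> s + c"
  shows "mark_mem s = mark_mem N"
proof (rule ext)
  fix a
  have "marker c h x (a - N) \<Longrightarrow> a < N + s \<and> a < N + N"
    using marker_bounds[of "a - N"] assms by linarith
  then show "mark_mem s a = mark_mem N a" unfolding mark_mem_def by presburger
qed

lemma mark_mem_initial: "mark_mem c = snd (input_state c x)"
proof (rule ext)
  fix a
  have "marker c h x (a - N) \<Longrightarrow> \<not> a < N + c"
    using marker_bounds[of "a - N"] c_pos by linarith
  then show "mark_mem c a = snd (input_state c x) a"
    unfolding mark_mem_def input_state_def snd_conv by presburger
qed

definition mark_inv :: "state \<Rightarrow> bool" where
  "mark_inv st \<longleftrightarrow> frame (fst st 3) st \<and> c \<le> fst st 3 \<and> fst st 3 \<le> N + c"

lemma mark_prog_correct: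
  "stops_within w h mark_prog (input_state c x) (70 * N + 10)
    (\<lambda>st. fst st 0 = N \<and> fst st 1 = c \<and> fst st 2 = 1 \<and> fst st 15 = 0 \<and> snd st = mark_mem N)"
  (is "stops_within _ _ _ _ _ ?Q")
proof -
  define body where "body = mark_body"
  \<comment> \<open>A round costs at most \<open>30 * c + 34\<close>, which is below
    \<open>70 * c - 1\<close> since \<open>c > 0\<close>, and advances \<open>s\<close> by
    \<open>c\<close>: this makes \<open>70\<close> per position, tests included.\<close>
  have body: "stops_within w h body st (70 * c - 1)
      (\<lambda>st'. mark_inv st' \<and> 70 * (N + c - fst st' 3) + (70 * c - 1) + 1 \<le> 70 * (N + c - fst st 3))"
    if inv: "mark_inv st" and guard: "fst st 4 < fst st 0" for st
  proof -
    define s where "s = fst st 3"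
    define Q where "Q st' \<longleftrightarrow>
      mark_inv st' \<and> 70 * (N + c - fst st' 3) + (70 * c - 1) + 1 \<le> 70 * (N + c - s)" for st'
    have frame: "frame s st" and s: "c \<le> s" "s + c < N"
      using inv guard by (auto simp: mark_inv_def s_def frame_def)
    have Q: "Q (R, M)" if "frame s (R(3 := s, 4 := s + c), mark_mem s)"
      "R 3 = s + c" "R 4 = s + c + c" "M = mark_mem (s + c)" for R M
      using that s c_pos by (simp add: Q_def mark_inv_def frame_def)
    have after_argmin: "stops_within w h check_argmin st' (20 * c + 28) Q"
      if st': "argmin_inv s st'" "\<not> fst st' 5 < fst st' 4" for st'
    proof -
      obtain R M where RM [simp]: "st' = (R, M)" by (cases st')
      define p where "p = R 6"
      have R: "R 0 = N" "R 1 = c" "R (Suc 0) = c" "R 2 = 1" "R 11 = 2" "R 3 = s" "R 4 = s + c" "R 15 = 0"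
        "M = mark_mem s" "R 6 = p" "R 7 = h (x ! p)" "s \<le> p" "p < s + c" "p < N"
        "\<forall>j\<in>{s..<s + c}. h (x ! p) \<le> h (x ! j)"
        using st' s by (auto simp: argmin_inv_def frame_def p_def)
      note step = mark_mem_step[OF s R(12,13,15)]
      have after_count: "stops_within w h (Seq set_mark
            (straight [Add 3 4 15, Add 4 3 1])) st'' 8 Q"
        if st'': "count_inv s p st''" "\<not> fst st'' 5 < fst st'' 9" and p: "p + c < N" for st''
      proof -
        obtain R M where RM [simp]: "st'' = (R, M)" by (cases st'')
        have R': "R 0 = N" "R 1 = c" "R (Suc 0) = c" "R 2 = 1" "R 11 = 2" "R 3 = s" "R 4 = s + c" "R 15 = 0"
          "M = mark_mem s" "R 6 = p" "R 10 = card (ties p (Suc (p + c)))"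
          using st'' by (auto simp: count_inv_def frame_def)
        have mk: "marker c h x p \<longleftrightarrow> card (ties p (Suc (p + c))) < 2"
          using s(1) R(12) p by (intro marker_iff_card_ties) auto
        show ?thesis
          apply (insert R' s R(12,13) p mk)
          apply (intro stops_within_intros)
          apply (simp_all add: step)
          apply (rule Q; simp add: frame_def step)+
          done
      qed
      show ?thesis
      proof (cases "p + c < N")
        case True
        have count: "stops_within w h count_loop st'' (20 * c + 11)
          (\<lambda>st'. count_inv s p st' \<and> \<not> fst st' 5 < fst st' 9)"
          if "count_inv s p st''" "fst st'' 5 = p - c" for st''
        proof (rule stops_within_mono[OF count_loop_correct[OF _ True that(1)]])
          show "c \<le> p" using s R by simp
          then show "10 * (Suc (p + c) - fst st'' 5) + 1 \<le> 20 * c + 11" using that(2) by simp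
        qed
        show ?thesis
          apply (insert R s True)
          apply (rule stops_within_straight_Seq, simp)
          apply (rule stops_within_IfLess_Seq, simp)
           apply (rule stops_within_Seq_assoc)
           apply (rule stops_within_straight_Seq, simp)
           apply (rule stops_within_Seq_assoc)
           apply (rule stops_within_Seq[OF count])
              apply (simp add: count_inv_def frame_def ties_def)
          subgoal by simp
          subgoal by simp
          subgoal for s'
            apply (rule stops_within_mono[OF after_count])
            subgoal by (rule conjunct1)
            subgoal by (rule conjunct2)
            subgoal by (rule True)
            subgoal by simp
            subgoal .
            done
          subgoal by simp
          done
      next
        case False
        then have "\<not> marker c h x p" by (simp add: marker_def)
        with step have step': "mark_mem (s + c) = mark_mem s" by simp
        show ?thesis
          apply (insert R s False)
          apply (intro stops_within_intros)
          apply simp_all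
          apply (rule Q; simp add: frame_def step')
          done
      qed
    qed
    obtain R M where RM [simp]: "st = (R, M)" by (cases st)
    have R: "R 0 = N" "R 1 = c" "R (Suc 0) = c" "R 2 = 1" "R 11 = 2" "R 3 = s" "R 4 = s + c" "R 15 = 0"
        "M = mark_mem s" using frame by (auto simp: frame_def)
    have argmin: "stops_within w h argmin_loop st' (10 * c + 1)
        (\<lambda>st'. argmin_inv s st' \<and> \<not> fst st' 5 < fst st' 4)" if "argmin_inv s st'" for st'
    proof (rule stops_within_mono[OF argmin_loop_correct[OF s(2) that]])
      show "10 * (s + c - fst st' 5) + 1 \<le> 10 * c + 1" using that by (auto simp: argmin_inv_def)
    qed
    have "stops_within w h body st (70 * c - 1) Q"
      unfolding body_def
      apply (insert R s c_pos)
      apply (rule stops_within_straight_Seq, simp)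
      apply (rule stops_within_Seq[OF argmin])
        apply (auto simp add: argmin_inv_def frame_def)[1]
       apply simp
      apply (rule stops_within_mono[OF after_argmin])
         apply simp_all
      done
    then show ?thesis unfolding Q_def s_def .
  qed
  have loop: "stops_within w h (WhileLess 4 0 body) st (70 * N + 1) ?Q"
    if "mark_inv st" "fst st 3 = c" for st
  proof (rule stops_within_mono)
    show "stops_within w h (WhileLess 4 0 body) st (70 * (N + c - fst st 3) + 1)
        (\<lambda>st'. mark_inv st' \<and> \<not> fst st' 4 < fst st' 0)"
      by (rule stops_within_WhileLess[where T = "70 * c - 1" and V = "\<lambda>st. 70 * (N + c - fst st 3)"])
        (use body that in auto)
    show "?Q st'" if "mark_inv st' \<and> \<not> fst st' 4 < fst st' 0" for st'
    proof -
      have "mark_mem (fst st' 3) = mark_mem N"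
        using that by (intro mark_mem_final) (auto simp: mark_inv_def frame_def)
      then show ?thesis using that by (simp add: mark_inv_def frame_def)
    qed
  qed (use that in simp)
  show ?thesis
    unfolding mark_prog_def body_def[symmetric]
    apply (insert c_pos)
    apply (rule stops_within_straight_Seq, simp)
    apply (rule stops_within_mono[OF loop])
       apply (auto simp: mark_inv_def frame_def input_state_def mark_mem_initial)
    done
qed

section \<open>Correctness of the output phase\<close>

definition stored :: "(nat \<Rightarrow> nat) \<Rightarrow> nat \<Rightarrow> nat list \<Rightarrow> bool" where
  "stored M a ys \<longleftrightarrow> (\<forall>k<length ys. M (a + k) = ys ! k)"

lemma stored_Nil [simp]: "stored M a []"
  by (simp add: stored_def)

lemma stored_Cons [simp]: "stored M a (y # ys) \<longleftrightarrow> M a = y \<and> stored M (Suc a) ys"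
  unfolding stored_def length_Cons All_less_Suc2 by (simp only: nth_Cons_0 nth_Cons_Suc add_0_right add_Suc_right add_Suc)

lemma stored_append [simp]:
  "stored M a (ys @ zs) \<longleftrightarrow> stored M a ys \<and> stored M (a + length ys) zs"
proof (induction ys arbitrary: a)
  case (Cons y ys)
  have "Suc a + length ys = a + length (y # ys)" by simp
  then show ?case unfolding append_Cons stored_Cons Cons.IH by (simp only: conj_assoc)
qed (simp only: append_Nil stored_Nil list.size add_0_right simp_thms)

lemma stored_upd [simp]:
  assumes "b < a \<or> a + length ys \<le> b"
  shows "stored (M(b := v)) a ys \<longleftrightarrow> stored M a ys"
proof -
  have "(M(b := v)) (a + k) = M (a + k)" if "k < length ys" for k
    using assms that by (intro fun_upd_other) linarith
  then show ?thesis unfolding stored_def by metis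
qed

lemma stored_map: "stored M a ys \<Longrightarrow> map M [a..<a + length ys] = ys"
  unfolding stored_def by (rule nth_equalityI) simp_all

definition enc :: "nat list list \<Rightarrow> nat list" where
  "enc bs = concat (map (\<lambda>B. length B # B) bs)"

lemma enc_Nil [simp]: "enc [] = []" and enc_append [simp]: "enc (bs @ cs) = enc bs @ enc cs"
  and enc_Cons [simp]: "enc (B # bs) = length B # B @ enc bs"
  by (simp_all add: enc_def)

lemma length_enc: "length (enc bs) = length bs + length (concat bs)"
  by (induction bs) auto

definition blks_upto :: "nat \<Rightarrow> nat list list" where
  "blks_upto i = blks c (take i (marked c h x))"

lemma blks_upto_0 [simp]: "blks_upto 0 = []"
  by (simp add: blks_upto_def)

lemma blks_upto_Suc: "i < N \<Longrightarrow> blks_upto (Suc i) = grow c (blks_upto i) (x ! i, marker c h x i)"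
proof -
  assume i: "i < N"
  then have "take (Suc i) (marked c h x) = take i (marked c h x) @ [marked c h x ! i]"
    by (intro take_Suc_conv_app_nth) simp
  also have "marked c h x ! i = (x ! i, marker c h x i)" using i by (simp add: marked_def)
  finally show ?thesis by (simp only: blks_upto_def blks_snoc)
qed

lemma blks_upto_eq_Nil_iff: "i \<le> N \<Longrightarrow> blks_upto i = [] \<longleftrightarrow> i = 0"
proof -
  assume "i \<le> N"
  then have "length (take i (marked c h x)) = i" by simp
  then show ?thesis unfolding blks_upto_def blks_eq_Nil_iff by (metis length_0_conv)
qed

lemma length_grow_le: "length (grow c bs p) \<le> Suc (length bs)"
  by (auto simp: grow_def)

lemma length_blks_upto_le: "i \<le> N \<Longrightarrow> length (blks_upto i) \<le> i"
proof (induction i)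
  case (Suc i)
  then show ?case
    using length_grow_le[of "blks_upto i" "(x ! i, marker c h x i)"] by (simp add: blks_upto_Suc)
qed simp

lemma length_enc_blks_upto: "i \<le> N \<Longrightarrow> length (enc (blks_upto i)) = length (blks_upto i) + i"
  unfolding length_enc by (simp add: blks_upto_def concat_blks)

lemma last_blks_upto_le: "i \<le> N \<Longrightarrow> i \<noteq> 0 \<Longrightarrow> length (last (blks_upto i)) \<le> c"
  using blks_length_le[OF c_pos, of "take i (marked c h x)"] blks_upto_eq_Nil_iff[of i]
    last_in_set[of "blks_upto i"] unfolding blks_upto_def by blast

text \<open>The length cell of the open block is rewritten with every letter, so the memory always
  holds a complete encoding of the blocks so far. At \<open>i = 0\<close> no block is open and
  register \<open>14\<close> holds \<open>c\<close>, which reads as full. Cell \<open>2 * N\<close>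
  is left for the number of blocks, known only at the end.\<close>

definition write_inv :: "state \<Rightarrow> bool" where
  "write_inv st \<longleftrightarrow> (let R = fst st; M = snd st; i = R 5; bs = blks_upto i in
     i \<le> N \<and> R 0 = N \<and> R 1 = c \<and> R 2 = 1 \<and> R 11 = 2 * N \<and> R 15 = 0 \<and> R 10 = length bs \<and>
     R 12 = 2 * N + 1 + length (enc bs) \<and> (i = 0 \<longrightarrow> R 14 = c) \<and>
     (i \<noteq> 0 \<longrightarrow> R 14 = length (last bs) \<and> R 13 + Suc (length (last bs)) = R 12) \<and>
     (\<forall>a<2 * N. M a = mark_mem N a) \<and> stored M (2 * N + 1) (enc bs))"

lemma write_loop_correct:
  assumes "write_inv st"
  shows "stops_within w h (WhileLess 5 0
       write_body)
     st (20 * (N - fst st 5) + 1) (\<lambda>st'. write_inv st' \<and> \<not> fst st' 5 < fst st' 0)"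
proof (rule stops_within_WhileLess[where T = 19 and V = "\<lambda>st. 20 * (N - fst st 5)"])
  fix st assume st: "write_inv st" "fst st 5 < fst st 0"
  obtain R M where RM [simp]: "st = (R, M)" by (cases st)
  define i where "i = R 5"
  define bs where "bs = blks_upto i"
  define isnew where "isnew \<longleftrightarrow> bs = [] \<or> marker c h x i \<or> length (last bs) = c"
  have R: "R 0 = N" "R 1 = c" "R (Suc 0) = c" "R 2 = 1" "R 11 = 2 * N" "R 15 = 0" "R 5 = i" "i < N"
    "R 10 = length bs" "R 12 = Suc (2 * N + length (enc bs))"
    "\<forall>a<2 * N. M a = mark_mem N a" "stored M (Suc (2 * N)) (enc bs)"
    using st by (auto simp: write_inv_def Let_def i_def bs_def)
  have R14: "i = 0 \<Longrightarrow> R 14 = c" "i \<noteq> 0 \<Longrightarrow> R 14 = length (last bs)"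
    "i \<noteq> 0 \<Longrightarrow> R 13 + Suc (length (last bs)) = R 12"
    using st by (auto simp: write_inv_def Let_def i_def bs_def)
  have bs: "length bs \<le> i" "length (enc bs) = length bs + i" "bs = [] \<longleftrightarrow> i = 0"
    using R by (simp_all add: bs_def length_blks_upto_le length_enc_blks_upto blks_upto_eq_Nil_iff)
  have R14_le: "R 14 \<le> c"
    using R14 last_blks_upto_le[of i] R by (cases "i = 0") (auto simp: bs_def)
  have len_iff: "marker c h x i \<Longrightarrow> isnew" "\<not> marker c h x i \<Longrightarrow> R 14 < c \<longleftrightarrow> \<not> isnew"
    using R14 R14_le bs(3) by (auto simp: isnew_def)
  have read: "M i = x ! i" "M (N + i) = (if marker c h x i then 1 else 0)"
    using R by (auto simp: mark_mem_def)
  have step: "blks_upto (Suc i) = (if isnew then bs @ [[x ! i]] else butlast bs @ [last bs @ [x ! i]])"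
    using R by (simp add: blks_upto_Suc grow_def isnew_def bs_def)
  define Q where "Q st' \<longleftrightarrow> write_inv st' \<and> 20 * (N - fst st' 5) + 19 + 1 \<le> 20 * (N - i)" for st'
  \<comment> \<open>A new block takes two cells, its length \<open>1\<close> and the letter;
    extending a block takes one cell and an update at the address in register
    \<open>13\<close>.\<close>
  have Q_new: "Q (R', M')"
    if "isnew" "R' 0 = N" "R' (Suc 0) = c" "R' 2 = 1" "R' 11 = 2 * N" "R' 15 = 0" "R' 5 = Suc i"
      "R' 10 = Suc (length bs)" "R' 12 = R 12 + 2" "R' 14 = 1" "R' 13 = R 12"
      "M' = M(Suc (R 12) := x ! i, R 12 := 1)" for R' M'
    using that R by (simp add: Q_def write_inv_def Let_def step)
  have Q_old: "Q (R', M')"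
    if "\<not> isnew" "R' 0 = N" "R' (Suc 0) = c" "R' 2 = 1" "R' 11 = 2 * N" "R' 15 = 0" "R' 5 = Suc i"
      "R' 10 = length bs" "R' 12 = Suc (R 12)" "R' 14 = Suc (R 14)" "R' 13 = R 13"
      "M' = M(R 12 := x ! i, R 13 := Suc (R 14))" for R' M'
  proof -
    have ne: "bs \<noteq> []" "i \<noteq> 0" using that(1) bs(3) by (auto simp: isnew_def)
    then obtain cs B where cs: "bs = cs @ [B]" by (metis rev_exhaust)
    have "R 14 = length B" "R 13 + Suc (length B) = R 12" using R14 ne cs by auto
    then show ?thesis using that R ne by (simp add: Q_def write_inv_def Let_def step cs)
  qed
  have "stops_within w h write_body
     st 19 Q"
  proof (cases isnew)
    case True
    show ?thesis
      apply (insert R bs R14_le read len_iff c_pos True)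
      apply (intro stops_within_intros)
      apply (simp_all split: if_splits)
      apply (rule Q_new; simp)+
      done
  next
    case False
    then have nm: "\<not> marker c h x i" "R 14 < c" using len_iff by auto
    have "R 13 < R 12" using R14 False bs(3) by (auto simp: isnew_def)
    show ?thesis
      apply (insert R bs R14_le read c_pos False nm \<open>R 13 < R 12\<close>)
      apply (intro stops_within_intros)
      apply simp_all
      apply (rule Q_old; simp)
      done
  qed
  then show "stops_within w h write_body
     st 19 (\<lambda>st'. write_inv st' \<and> 20 * (N - fst st' 5) + 19 + 1 \<le> 20 * (N - fst st 5))"
    unfolding Q_def i_def RM fst_conv .
qed (use assms in auto)

lemma write_prog_correct:
  assumes "fst st 0 = N" "fst st 1 = c" "fst st 2 = 1" "fst st 15 = 0" "snd st = mark_mem N"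
  shows "stops_within w h write_prog st (20 * N + 10)
    (\<lambda>st'. map (snd st') [fst st' 0..<fst st' 0 + length (encode_blocks (phi c h x))]
      = encode_blocks (phi c h x))"
    (is "stops_within _ _ _ _ _ ?Q")
proof -
  obtain R M where RM [simp]: "st = (R, M)" by (cases st)
  have R: "R 0 = N" "R 1 = c" "R (Suc 0) = c" "R 2 = 1" "R 15 = 0" "M = mark_mem N" using assms by auto
  have full: "blks_upto N = phi c h x" by (simp add: blks_upto_def phi_eq_blks[OF c_pos])
  have final: "stops_within w h (straight [Store 11 10, Add 0 11 15]) st' 3 ?Q"
    if "write_inv st'" "\<not> fst st' 5 < fst st' 0" for st'
  proof -
    obtain R M where RM [simp]: "st' = (R, M)" by (cases st')
    have R: "R 11 = 2 * N" "R 15 = 0" "R 10 = length (phi c h x)" "stored M (Suc (2 * N)) (enc (phi c h x))"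
      using that full by (auto simp: write_inv_def Let_def dest!: le_antisym)
    have "stored (M(2 * N := length (phi c h x))) (2 * N) (encode_blocks (phi c h x))"
      using R(4) by (simp add: encode_blocks_def flip: enc_def)
    then have "map (M(2 * N := length (phi c h x))) [2 * N..<2 * N + length (encode_blocks (phi c h x))]
        = encode_blocks (phi c h x)" by (rule stored_map)
    then show ?thesis
      using R c_pos by (intro stops_within_straight) simp_all
  qed
  have loop: "stops_within w h (WhileLess 5 0
       write_body)
     st' (20 * N + 1) (\<lambda>st'. write_inv st' \<and> \<not> fst st' 5 < fst st' 0)"
    if "write_inv st'" "fst st' 5 = 0" for st'
    using write_loop_correct[OF that(1)] that(2) by simp
  show ?thesis
    unfolding write_prog_def
    apply (insert R c_pos)
    apply (rule stops_within_straight_Seq, simp)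
    apply (rule stops_within_Seq[OF loop])
    subgoal by (simp add: write_inv_def)
    subgoal by simp
    subgoal by simp
    subgoal for s'
      apply (rule stops_within_mono[OF final])
      subgoal by (rule conjunct1)
      subgoal by (rule conjunct2)
      subgoal by simp
      subgoal .
      done
    done
qed

lemma phi_prog_correct:
  "computes_within phi_prog w h c x (phi c h x) (90 * real N + 20)"
proof -
  have "stops_within w h phi_prog (input_state c x) (90 * N + 20)
      (\<lambda>st'. map (snd st') [fst st' 0..<fst st' 0 + length (encode_blocks (phi c h x))]
      = encode_blocks (phi c h x))"
    unfolding phi_prog_def
  proof (rule stops_within_Seq[OF mark_prog_correct])
    have T: "90 * N + 20 - (70 * N + 10) = 20 * N + 10" by simp
    show "stops_within w h write_prog st (90 * N + 20 - (70 * N + 10))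
      (\<lambda>st'. map (snd st') [fst st' 0..<fst st' 0 + length (encode_blocks (phi c h x))]
        = encode_blocks (phi c h x))"
      if "fst st 0 = N \<and> fst st 1 = c \<and> fst st 2 = 1 \<and> fst st 15 = 0 \<and> snd st = mark_mem N" for st
      unfolding T using that by (elim conjE) (rule write_prog_correct)
  qed simp
  then obtain t st where "run w h phi_prog (input_state c x) t st" "t \<le> 90 * N + 20"
    "map (snd st) [fst st 0..<fst st 0 + length (encode_blocks (phi c h x))] = encode_blocks (phi c h x)"
    unfolding stops_within_def by blast
  moreover from this(2) have "real t \<le> 90 * real N + 20"
    by (metis (mono_tags) of_nat_add of_nat_le_iff of_nat_mult of_nat_numeral)
  ultimately show ?thesis
    unfolding computes_within_def by (intro exI[of _ t] exI[of _ "fst st"] exI[of _ "snd st"]) simp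
qed

end


section \<open>The theorem\<close>

text \<open>Origin of \<open>b = 8 * c\<close>: from \<open>4 * c <= n\<close> follows
  \<open>log 2 n >= 1\<close>, hence at least \<open>8 * c\<close> bits, and
  \<open>8 * c < 2 ^ (8 * c)\<close>.\<close>

lemma hash_bits_large:
  assumes "c > 0" "4 * c \<le> n"
  shows "8 * c \<le> 2 ^ hash_bits (8 * c) n"
proof -
  have "1 \<le> log 2 (real n)" using assms by simp
  then have "real (8 * c) * 1 \<le> real (8 * c) * log 2 (real n)" by (intro mult_left_mono) auto
  then have "8 * c \<le> hash_bits (8 * c) n" unfolding hash_bits_def by linarith
  also have "\<dots> < 2 ^ hash_bits (8 * c) n" by (rule less_exp)
  finally show ?thesis by simp
qed

text \<open>The exponent of \<open>prob_exp_tail_sum\<close>, cut off at \<open>0\<close> since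
  \<open>f\<close> must be nonnegative; there the bound is \<open>1\<close>, which every probability
  meets.\<close>

definition tail_exponent :: "nat \<Rightarrow> real" where
  "tail_exponent m = max 0 (ln (7 / 6) * (real m - 20) / (64 * ln 2) - 2)"

lemma tail_exponent_bigomega: "tail_exponent \<in> \<Omega>(\<lambda>m. real m)"
proof -
  define r :: real where "r = ln (7 / 6) / (64 * ln 2)"
  have r: "r > 0" by (simp add: r_def)
  \<comment> \<open>From \<open>40 + 4 / r\<close> on, half of \<open>r * m\<close> absorbs the
    subtracted \<open>20 * r + 2\<close>.\<close>
  have "eventually (\<lambda>m. real m \<ge> 40 + 4 / r) sequentially"
    using filterlim_real_sequentially by (auto simp: filterlim_at_top)
  then have "eventually (\<lambda>m. norm (tail_exponent m) \<ge> (r / 2) * norm (real m)) sequentially"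
  proof (rule eventually_mono)
    fix m assume "40 + 4 / r \<le> real m"
    then have "r * (40 + 4 / r) \<le> r * real m" using r by (intro mult_left_mono) auto
    then have "r * real m / 2 \<le> r * (real m - 20) - 2" using r by (simp add: algebra_simps)
    also have "r * (real m - 20) - 2 \<le> tail_exponent m" by (simp add: tail_exponent_def r_def)
    finally show "(r / 2) * norm (real m) \<le> norm (tail_exponent m)" by simp
  qed
  then show ?thesis using r by (intro landau_omega.bigI[of "r / 2"]) auto
qed

theorem theorem35:
  shows "\<exists>(C::real) (f::nat \<Rightarrow> real) (prog::com) (W::nat).
    (\<forall>m. f m \<ge> 0) \<and> f \<in> \<Omega>(\<lambda>m. real m) \<and>
    (\<forall>(p::nat \<Rightarrow> real) (c::nat).
      (\<forall>n. p n > 0) \<and> (\<exists>k::nat. p \<in> O(\<lambda>n. real n ^ k)) \<and> c > 0 \<and> even c \<longrightarrow>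
      (\<exists>b::nat. b > 0 \<and>
        (\<forall>(n::nat) (A::nat set) (H::(nat \<Rightarrow> nat) pmf).
          n \<ge> 1 \<and> k_wise_indep_family n A (hash_bits b n) H \<longrightarrow>
          expected_distortion_le H (phi c) (perms_le n A)
            (\<lambda>x y. real (edit_distance x y)) (\<lambda>u v. real (edit_distance u v)) (C * real c) \<and>
          (\<forall>x\<in>perms_le n A. \<forall>y\<in>perms_le n A.
            (\<forall>h\<in>set_pmf H.
              real (length (phi c h x)) \<le> C * max 1 (real (length x) / real c) \<and>
              real (length (phi c h y)) \<le> C * max 1 (real (length y) / real c) \<and>
              edit_distance x y \<le> c * edit_distance (phi c h x) (phi c h y)) \<and>
            (\<forall>m::nat.
              measure_pmf.prob H
                {h. edit_distance (phi c h x) (phi c h y) > m * edit_distance x y}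
              \<le> (1 / 2) powr f m + 1 / p n) \<and>
            (\<forall>h\<in>set_pmf H. \<forall>w::nat.
              A \<subseteq> {..<2 ^ w} \<and> hash_bits b n \<le> w \<and> W * (n + c) \<le> 2 ^ w \<longrightarrow>
              computes_within prog w h c x (phi c h x) (C * real n) \<and>
              computes_within prog w h c y (phi c h y) (C * real n))))))"
\<comment> \<open>The schematic witnesses are fixed by the goals shown: \<open>C = 1556\<close>,
  \<open>f = tail_exponent\<close>, \<open>prog = phi_prog\<close>, \<open>W = 8\<close> and
  \<open>b = 8 * c\<close>. The expectation dictates \<open>C\<close>; the lengths would allow
  \<open>5\<close> and the time \<open>110\<close>.\<close>
proof (intro exI conjI allI impI)
  show "tail_exponent m \<ge> 0" for m by (simp add: tail_exponent_def)
  show "tail_exponent \<in> \<Omega>(\<lambda>m. real m)" by (rule tail_exponent_bigomega)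
next
  fix p :: "nat \<Rightarrow> real" and c :: nat
  assume A: "(\<forall>n. p n > 0) \<and> (\<exists>k::nat. p \<in> O(\<lambda>n. real n ^ k)) \<and> c > 0 \<and> even c"
  then have c: "c > 0" and p: "\<And>n. p n > 0" by auto
  show "8 * c > 0" using c by simp
  fix n :: nat and A :: "nat set" and H :: "(nat \<Rightarrow> nat) pmf"
  assume H: "n \<ge> 1 \<and> k_wise_indep_family n A (hash_bits (8 * c) n) H"
  then have fam: "k_wise_indep_family n A (hash_bits (8 * c) n) H" by simp
  have bits: "4 * c \<le> n \<longrightarrow> 8 * c \<le> 2 ^ hash_bits (8 * c) n" using hash_bits_large[OF c] by simp
  have noncontr: "edit_distance x y \<le> c * edit_distance (phi c h x) (phi c h y)" for h and x y :: "nat list"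
    by (rule phi_noncontracting[OF c])
  have dist: "measure_pmf.expectation H (\<lambda>h. real (edit_distance (phi c h x) (phi c h y)))
        \<le> 1556 * real (edit_distance x y)"
      "integrable (measure_pmf H) (\<lambda>h. real (edit_distance (phi c h x) (phi c h y)))"
      "measure_pmf.prob H {h. edit_distance (phi c h x) (phi c h y) > m * edit_distance x y}
        \<le> (1 / 2) powr (ln (7 / 6) * (real m - 20) / (64 * ln 2) - 2)"
    if xy: "x \<in> perms_le n A" "y \<in> perms_le n A" for x y m
  proof -
    obtain Ds where Ds: "length Ds \<le> 2 * edit_distance x y" "\<forall>D\<in>set Ds. exp_tail H D"
      "\<And>h. edit_distance (phi c h x) (phi c h y) \<le> (\<Sum>D\<leftarrow>Ds. D h)"
      by (rule phi_distance_le_sum[OF fam c bits xy]) blast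
    note sum = expectation_exp_tail_sum[where Y = "\<lambda>h. edit_distance (phi c h x) (phi c h y)", OF Ds(2,3,1)]
      integrable_exp_tail_sum[where Y = "\<lambda>h. edit_distance (phi c h x) (phi c h y)", OF Ds(2,3,1)]
      prob_exp_tail_sum[where Y = "\<lambda>h. edit_distance (phi c h x) (phi c h y)", OF Ds(2,3,1)]
    show "measure_pmf.expectation H (\<lambda>h. real (edit_distance (phi c h x) (phi c h y)))
        \<le> 1556 * real (edit_distance x y)"
      "integrable (measure_pmf H) (\<lambda>h. real (edit_distance (phi c h x) (phi c h y)))"
      "measure_pmf.prob H {h. edit_distance (phi c h x) (phi c h y) > m * edit_distance x y}
        \<le> (1 / 2) powr (ln (7 / 6) * (real m - 20) / (64 * ln 2) - 2)"
      using sum by blast+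
  qed
  show "expected_distortion_le H (phi c) (perms_le n A)
      (\<lambda>x y. real (edit_distance x y)) (\<lambda>u v. real (edit_distance u v)) (1556 * real c)"
    unfolding expected_distortion_le_def
  \<comment> \<open>Scaling by \<open>c\<close> makes the map non-contracting. As the expectation
    bound is free of \<open>c\<close>, this factor is the whole distortion up to a constant.\<close>
  proof (intro exI[of _ "real c"] conjI ballI)
    fix x y assume xy: "x \<in> perms_le n A" "y \<in> perms_le n A"
    show "real (edit_distance x y) \<le> real c * real (edit_distance (phi c h x) (phi c h y))" for h
      using noncontr[of x y h] by (simp flip: of_nat_mult)
    show "integrable (measure_pmf H) (\<lambda>h. real (edit_distance (phi c h x) (phi c h y)))"
      by (rule dist(2)[OF xy])
    show "real c * measure_pmf.expectation H (\<lambda>h. real (edit_distance (phi c h x) (phi c h y)))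
        \<le> 1556 * real c * real (edit_distance x y)"
      using mult_left_mono[OF dist(1)[OF xy], of "real c"] by (simp add: mult_ac)
  qed (use c in simp)
  have len: "real (length (phi c h x)) \<le> 1556 * max 1 (real (length x) / real c)"
    for h and x :: "nat list"
  proof -
    have "real c * real (length (phi c h x)) \<le> 2 * real (length x) + 3 * real c"
      using of_nat_mono[OF length_phi_le[OF c, of h x], where 'a = real] by simp
    then have "real (length (phi c h x)) \<le> 2 * (real (length x) / real c) + 3"
      using c by (simp add: field_simps)
    then show ?thesis by (auto simp: max_def)
  qed
  have time: "computes_within phi_prog w h c x (phi c h x) (1556 * real n)"
    if "x \<in> perms_le n A" "h \<in> set_pmf H" and w: "hash_bits (8 * c) n \<le> w" "8 * (n + c) \<le> 2 ^ w"
    for x h w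
  proof -
    have x: "set x \<subseteq> A" "length x \<le> n" using that by (auto simp: perms_le_def)
    have "ram_input w h c x"
    proof
      show "8 * (length x + c) \<le> 2 ^ w" 
        using x(2) by (intro order_trans[OF _ w(2)]) simp
      show "h a < 2 ^ w" if "a \<in> set x" for a
      proof -
        have "h a < 2 ^ hash_bits (8 * c) n"
          using hash_less[OF fam \<open>h \<in> set_pmf H\<close>] x(1) that by blast
        also have "\<dots> \<le> 2 ^ w" using w(1) by (intro power_increasing) auto
        finally show ?thesis .
      qed
    qed (rule c)
    then have "computes_within phi_prog w h c x (phi c h x) (90 * real (length x) + 20)"
      by (rule ram_input.phi_prog_correct)
    moreover have "90 * real (length x) + 20 \<le> 1556 * real n" using x(2) H by simp
    ultimately show ?thesis unfolding computes_within_def by (blast intro: order_trans)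
  qed
  show "\<forall>x\<in>perms_le n A. \<forall>y\<in>perms_le n A.
      (\<forall>h\<in>set_pmf H.
        real (length (phi c h x)) \<le> 1556 * max 1 (real (length x) / real c) \<and>
        real (length (phi c h y)) \<le> 1556 * max 1 (real (length y) / real c) \<and>
        edit_distance x y \<le> c * edit_distance (phi c h x) (phi c h y)) \<and>
      (\<forall>m::nat.
        measure_pmf.prob H
          {h. edit_distance (phi c h x) (phi c h y) > m * edit_distance x y}
        \<le> (1 / 2) powr tail_exponent m + 1 / p n) \<and>
      (\<forall>h\<in>set_pmf H. \<forall>w::nat.
        A \<subseteq> {..<2 ^ w} \<and> hash_bits (8 * c) n \<le> w \<and> 8 * (n + c) \<le> 2 ^ w \<longrightarrow>
        computes_within phi_prog w h c x (phi c h x) (1556 * real n) \<and>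
        computes_within phi_prog w h c y (phi c h y) (1556 * real n))"
  proof (intro ballI conjI allI impI)
    fix x y m assume xy: "x \<in> perms_le n A" "y \<in> perms_le n A"
    have "measure_pmf.prob H {h. edit_distance (phi c h x) (phi c h y) > m * edit_distance x y}
        \<le> (1 / 2) powr tail_exponent m"
      using dist(3)[OF xy, of m] by (auto simp: tail_exponent_def max_def)
    also have "\<dots> \<le> (1 / 2) powr tail_exponent m + 1 / p n" using p[of n] by simp
    finally show "measure_pmf.prob H
        {h. edit_distance (phi c h x) (phi c h y) > m * edit_distance x y}
        \<le> (1 / 2) powr tail_exponent m + 1 / p n" .
  qed (use len noncontr time in auto)
qed

end
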